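(* Let $\{f_k\}_{k=1}^\infty$ be a near-Riesz basis for a Hilbert space $\mathcal{H}$, with frame operator $S$. If $\{h_k\}_{k=1}^\infty$ is a sequence in $\mathcal{H}$ which satisfies $\mu:=\sum_{k=1}^\infty\|f_k-h_k\|\,\|S^{-1}(f_k)\|<1$, then $\{h_k\}_{k=1}^\infty$ is a near-Riesz basis for $\mathcal{H}$; in this case, $\{f_k\}_{k=1}^\infty$ and $\{h_k\}_{k=1}^\infty$ have the same excess.
   Context: A sequence $\{f_k\}_{k=1}^\infty$ in a Hilbert space $\mathcal{H}$ is a frame for $\mathcal{H}$ if there are constants $A,B>0$ with $A\|f\|^2\le\sum_{k=1}^\infty|\langle f,f_k\rangle|^2\le B\|f\|^2$ for all $f\in\mathcal{H}$. Its frame operator is $S:\mathcal{H}\to\mathcal{H}$, $S(f)=\sum_{k=1}^\infty\langle f,f_k\rangle f_k$, which is bounded and invertible. A Riesz basis for $\mathcal{H}$ is a family $\{U(e_k)\}_{k=1}^\infty$ where $\{e_k\}_{k=1}^\infty$ is an orthonormal basis of $\mathcal{H}$ and $U:\mathcal{H}\to\mathcal{H}$ is a bounded invertible operator; equivalently, it is a sequence that is complete in $\mathcal{H}$ (has dense linear span) and for which there are constants $A,B>0$ such that $A\sum_{k=1}^n|c_k|^2\le\|\sum_{k=1}^n c_kf_k\|^2\le B\sum_{k=1}^n|c_k|^2$ for all finite scalar sequences $\{c_k\}_{k=1}^n$. A frame for $\mathcal{H}$ is called a near-Riesz basis if it consists of a Riesz basis for $\mathcal{H}$ and a finite number of extra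 elements, i.e. removing finitely many (possibly zero) suitable terms (indices) leaves a Riesz basis. The excess of a near-Riesz basis is the number of elements which have to be removed to obtain a Riesz basis. *)

theory Defs
  imports "HOL-Analysis.Analysis"
begin

text \<open>
  Hilbert spaces are treated over the real and the complex scalars at once. The scalar field is
  a complete normed field with a conjugation; the axioms determine the conjugation, and by the
  Gelfand--Mazur theorem the only such fields are, up to isomorphism, the reals with the identity
  and the complex numbers with \<^const>\<open>cnj\<close>.
\<close>

class hilbert_scalar = real_normed_field + banach +
  fixes scalar_conj :: "'a \<Rightarrow> 'a"
  assumes scalar_conj_add: "scalar_conj (a + b) = scalar_conj a + scalar_conj b"
    and scalar_conj_mult: "scalar_conj (a * b) = scalar_conj a * scalar_conj b"
    and scalar_conj_mult_self: "scalar_conj a * a = (norm a)\<^sup>2 *\<^sub>R 1"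

instantiation real :: hilbert_scalar
begin
definition scalar_conj_real :: "real \<Rightarrow> real" where "scalar_conj_real x = x"
instance by standard (simp_all add: scalar_conj_real_def power2_eq_square)
end

instantiation complex :: hilbert_scalar
begin
definition scalar_conj_complex :: "complex \<Rightarrow> complex" where "scalar_conj_complex = cnj"
instance
  by standard (simp_all add: scalar_conj_complex_def complex_norm_square mult.commute scaleR_conv_of_real
      del: of_real_power)
end

text \<open>
  Completeness comes from the class \<^class>\<open>banach\<close>; the two compatibility conditions say that its
  real scalar multiplication and its norm are the ones induced by \<open>smul\<close> and \<open>ip\<close>.
  The inner product is linear in its first argument.
\<close>

locale hilbert_space = vector_space smul
  for smul :: "'k::hilbert_scalar \<Rightarrow> 'h::banach \<Rightarrow> 'h" +
  fixes ip :: "'h \<Rightarrow> 'h \<Rightarrow> 'k"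
  assumes scale_of_real: "smul (of_real r) x = r *\<^sub>R x"
    and ip_add_left: "ip (x + y) z = ip x z + ip y z"
    and ip_scale_left: "ip (smul a x) y = a * ip x y"
    and ip_commute: "ip y x = scalar_conj (ip x y)"
    and ip_self: "ip x x = of_real ((norm x)\<^sup>2)"

lemma hilbert_space_real:
  "hilbert_space (scaleR :: real \<Rightarrow> 'h \<Rightarrow> 'h) (inner :: 'h::{real_inner,banach} \<Rightarrow> 'h \<Rightarrow> real)"
  by unfold_locales
    (simp_all add: algebra_simps scalar_conj_real_def inner_commute power2_norm_eq_inner)

lemma hilbert_space_complex:
  "hilbert_space ((*) :: complex \<Rightarrow> complex \<Rightarrow> complex) (\<lambda>x y. x * cnj y)"
  by unfold_locales
    (simp_all add: algebra_simps scalar_conj_complex_def scaleR_conv_of_real complex_norm_square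
      del: of_real_power)

text \<open>Sequences are indexed from 0 instead of 1.\<close>

definition is_frame :: "('h::banach \<Rightarrow> 'h \<Rightarrow> 'k::hilbert_scalar) \<Rightarrow> (nat \<Rightarrow> 'h) \<Rightarrow> bool" where
  "is_frame ip f \<longleftrightarrow>
     (\<exists>A>0. \<exists>B>0. \<forall>g. summable (\<lambda>k. (norm (ip g (f k)))\<^sup>2) \<and>
        A * (norm g)\<^sup>2 \<le> (\<Sum>k. (norm (ip g (f k)))\<^sup>2) \<and>
        (\<Sum>k. (norm (ip g (f k)))\<^sup>2) \<le> B * (norm g)\<^sup>2)"

definition frame_operator ::
    "('k::hilbert_scalar \<Rightarrow> 'h::banach \<Rightarrow> 'h) \<Rightarrow> ('h \<Rightarrow> 'h \<Rightarrow> 'k) \<Rightarrow> (nat \<Rightarrow> 'h) \<Rightarrow> 'h \<Rightarrow> 'h" where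
  "frame_operator smul ip f g = (\<Sum>k. smul (ip g (f k)) (f k))"

definition orthonormal_basis_on ::
    "('k::hilbert_scalar \<Rightarrow> 'h::banach \<Rightarrow> 'h) \<Rightarrow> ('h \<Rightarrow> 'h \<Rightarrow> 'k) \<Rightarrow> nat set \<Rightarrow> (nat \<Rightarrow> 'h) \<Rightarrow> bool" where
  "orthonormal_basis_on smul ip I e \<longleftrightarrow>
     (\<forall>i\<in>I. \<forall>j\<in>I. ip (e i) (e j) = (if i = j then 1 else 0)) \<and>
     closure (module.span smul (e ` I)) = UNIV"

definition bounded_invertible_operator ::
    "('k::hilbert_scalar \<Rightarrow> 'h::banach \<Rightarrow> 'h) \<Rightarrow> ('h \<Rightarrow> 'h) \<Rightarrow> bool" where
  "bounded_invertible_operator smul U \<longleftrightarrow>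
     Vector_Spaces.linear smul smul U \<and> bounded_linear U \<and> bij U \<and> bounded_linear (inv U)"

text \<open>
  A Riesz basis is a family over an arbitrary index set \<open>I\<close>, so that removing the terms with
  indices in \<open>F\<close> from a sequence means passing to the index set \<open>- F\<close>, without renumbering.
\<close>

definition riesz_basis_on ::
    "('k::hilbert_scalar \<Rightarrow> 'h::banach \<Rightarrow> 'h) \<Rightarrow> ('h \<Rightarrow> 'h \<Rightarrow> 'k) \<Rightarrow> nat set \<Rightarrow> (nat \<Rightarrow> 'h) \<Rightarrow> bool" where
  "riesz_basis_on smul ip I f \<longleftrightarrow>
     (\<exists>e U. orthonormal_basis_on smul ip I e \<and> bounded_invertible_operator smul U \<and>
        (\<forall>k\<in>I. f k = U (e k)))"

definition near_riesz_basis ::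
    "('k::hilbert_scalar \<Rightarrow> 'h::banach \<Rightarrow> 'h) \<Rightarrow> ('h \<Rightarrow> 'h \<Rightarrow> 'k) \<Rightarrow> (nat \<Rightarrow> 'h) \<Rightarrow> bool" where
  "near_riesz_basis smul ip f \<longleftrightarrow>
     is_frame ip f \<and> (\<exists>F. finite F \<and> riesz_basis_on smul ip (- F) f)"

definition excess ::
    "('k::hilbert_scalar \<Rightarrow> 'h::banach \<Rightarrow> 'h) \<Rightarrow> ('h \<Rightarrow> 'h \<Rightarrow> 'k) \<Rightarrow> (nat \<Rightarrow> 'h) \<Rightarrow> nat" where
  "excess smul ip f =
     (LEAST n. \<exists>F. finite F \<and> card F = n \<and> riesz_basis_on smul ip (- F) f)"

end

theory Submission imports Defs begin

text \<open>
  Let \<open>F\<close> be a finite set of indices whose removal from \<open>f\<close> leaves a Riesz basis. The norms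
  \<open>\<parallel>S\<^sup>-\<^sup>1 f\<^sub>k\<parallel>\<close> with \<open>k \<notin> F\<close> are bounded away from zero, so \<open>\<Sum>\<^sub>k \<parallel>f\<^sub>k - h\<^sub>k\<parallel>\<close>
  converges. Hence replacing \<open>f\<^sub>k\<close> by \<open>h\<^sub>k\<close> for \<open>k \<ge> N\<close> with \<open>N\<close> large perturbs the Riesz basis
  \<open>(f\<^sub>k)\<close>, \<open>k \<notin> F\<close>, into another Riesz basis \<open>(g\<^sub>k)\<close>, \<open>k \<notin> F\<close>. On the other hand, \<open>\<mu> < 1\<close> and
  \<open>x = \<Sum>\<^sub>k \<langle>x, S\<^sup>-\<^sup>1 f\<^sub>k\<rangle> f\<^sub>k\<close> show that \<open>h\<close> is complete. Adjoining to \<open>(h\<^sub>k)\<close>, \<open>k \<ge> N\<close>,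
  some of the vectors \<open>h\<^sub>0, \<dots>, h\<^bsub>N-1\<^esub>\<close>, each outside the closed span of the previous ones, yields a
  Riesz basis. The number of adjoined vectors is the codimension of the closed span of the common
  tail of \<open>g\<close> and \<open>h\<close>, so it equals \<open>N - card F\<close>.
\<close>

section \<open>Density criteria and l2 norms of finite families\<close>

text \<open>Let \<open>d\<close> be the distance from \<open>g\<close> to \<open>W\<close>.
  Approximating the residual \<open>g - w\<close> by some \<open>w'\<close> produces the element
  \<open>w + w'\<close> of \<open>W\<close>, whence \<open>d <= q * norm (g - w)\<close> for every
  \<open>w\<close>. Passing to the infimum gives \<open>d <= q * d\<close>, so
  \<open>d = 0\<close>.\<close>

lemma additive_subset_dense:
  fixes W :: "'a::real_normed_vector set"
  assumes "0 \<in> W" and add: "\<And>v w. v \<in> W \<Longrightarrow> w \<in> W \<Longrightarrow> v + w \<in> W"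
    and "q < 1" and approx: "\<And>g. \<exists>w\<in>W. norm (g - w) \<le> q * norm g"
  shows "closure W = UNIV"
proof -
  have "g \<in> closure W" for g
  proof -
    define d where "d = infdist g W"
    have ne: "W \<noteq> {}" using assms(1) by blast
    have d0: "d \<ge> 0" by (simp add: d_def infdist_nonneg)
    have *: "d \<le> q * norm (g - w)" if "w \<in> W" for w
    proof -
      obtain w' where "w' \<in> W" "norm (g - w - w') \<le> q * norm (g - w)" using approx by blast
      moreover have "d \<le> norm (g - (w + w'))"
        unfolding d_def using infdist_le[OF add[OF that \<open>w' \<in> W\<close>], of g] by (simp add: dist_norm)
      ultimately show ?thesis by (simp add: diff_diff_eq)
    qed
    have "d = 0"
    proof (rule ccontr)
      assume "d \<noteq> 0"
      with d0 have "d > 0" by simp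
      \<comment> \<open>Taking \<open>w = 0\<close> in the inequality above, \<open>q <= 0\<close>
        would force \<open>d <= 0\<close>; the sign permits division by \<open>q\<close>.\<close>
      have "q > 0"
      proof (rule ccontr)
        assume "\<not> q > 0"
        then have "q * norm (g - 0) \<le> 0" by (simp add: mult_nonpos_nonneg)
        then show False using *[OF assms(1)] \<open>d > 0\<close> by simp
      qed
      have "d / q \<le> infdist g W"
        unfolding infdist_notempty[OF ne]
        using * \<open>q > 0\<close> ne by (intro cINF_greatest) (auto simp: dist_norm field_simps)
      then show False
        using \<open>d > 0\<close> \<open>q > 0\<close> \<open>q < 1\<close> by (simp add: d_def[symmetric] divide_le_eq)
    qed
    then show ?thesis using ne by (simp add: d_def in_closure_iff_infdist_zero)
  qed
  then show ?thesis by auto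
qed

text \<open>The lower bound pulls Cauchy sequences in the range back to Cauchy sequences in a
  complete space, so the range is complete, hence closed.\<close>

lemma range_UNIV_if_bounded_below_dense:
  fixes U :: "'a::banach \<Rightarrow> 'b::real_normed_vector"
  assumes "bounded_linear U" "A > 0" "\<And>x. A * norm x \<le> norm (U x)" "closure (range U) = UNIV"
  shows "range U = UNIV"
proof -
  have "complete (range U)"
    by (rule complete_isometric_image[OF \<open>A > 0\<close>])
      (use assms in \<open>auto simp: complete_eq_closed\<close>)
  then show ?thesis using assms(4) complete_imp_closed closure_closed by metis
qed

lemma L2_set_mono_set:
  assumes "finite K" "J \<subseteq> K"
  shows "L2_set f J \<le> L2_set f K"
  unfolding L2_set_def using assms by (intro real_sqrt_le_mono sum_mono2) auto

lemma sum_le_L2_set_mult: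
  assumes "\<And>k. k \<in> J \<Longrightarrow> 0 \<le> f k" "\<And>k. k \<in> J \<Longrightarrow> 0 \<le> g k"
  shows "(\<Sum>k\<in>J. f k * g k) \<le> L2_set f J * L2_set g J"
proof -
  have "(\<Sum>k\<in>J. f k * g k) = (\<Sum>k\<in>J. \<bar>f k\<bar> * \<bar>g k\<bar>)"
    using assms by (intro sum.cong) auto
  then show ?thesis using L2_set_mult_ineq[of f g J] by simp
qed

section \<open>Conjugation on the scalar field\<close>

text \<open>At a real \<open>r\<close> the axiom \<open>scalar_conj_mult_self\<close> reads conj(r)
  r = r^2, and a nonzero \<open>r\<close> cancels; the value at 0 comes from additivity.\<close>

lemma scalar_conj_of_real: "scalar_conj (of_real r :: 'k::hilbert_scalar) = of_real r"
proof (cases "r = 0")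
  case True
  have "scalar_conj (0::'k) + scalar_conj 0 = scalar_conj 0"
    using scalar_conj_add[of "0::'k" 0] by simp
  with True show ?thesis by simp
next
  case False
  have "scalar_conj (of_real r :: 'k) * of_real r = of_real r * of_real r"
    using scalar_conj_mult_self[of "of_real r :: 'k"]
    by (simp add: scaleR_conv_of_real power2_eq_square)
  with False show ?thesis by simp
qed

lemma norm_scalar_conj: "norm (scalar_conj (a::'k::hilbert_scalar)) = norm a"
proof (cases "a = 0")
  case True
  then show ?thesis using scalar_conj_of_real[of 0] by simp
next
  case False
  have "norm (scalar_conj a) * norm a = norm a * norm a"
    using scalar_conj_mult_self[of a] by (simp flip: norm_mult add: power2_eq_square)
  with False show ?thesis by simp
qed

lemma mult_scalar_conj: "a * scalar_conj a = (of_real (norm (a::'k::hilbert_scalar)))\<^sup>2"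
  using scalar_conj_mult_self[of a] by (simp add: scaleR_conv_of_real mult.commute)

lemma bounded_linear_scalar_conj: "bounded_linear (scalar_conj :: 'k::hilbert_scalar \<Rightarrow> 'k)"
proof (rule bounded_linear_intro[of _ 1])
  show "scalar_conj (r *\<^sub>R x) = r *\<^sub>R scalar_conj x" for r and x :: 'k
    by (simp add: scaleR_conv_of_real scalar_conj_mult scalar_conj_of_real)
qed (simp_all add: scalar_conj_add norm_scalar_conj)

section \<open>Inner product geometry over a general scalar field\<close>

context hilbert_space
begin

lemma ip_add_right: "ip x (y + z) = ip x y + ip x z"
  by (metis ip_add_left ip_commute scalar_conj_add)

lemma ip_scale_right: "ip x (smul a y) = scalar_conj a * ip x y"
  by (metis ip_scale_left ip_commute scalar_conj_mult)

lemma norm_ip_commute: "norm (ip x y) = norm (ip y x)"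
  by (metis ip_commute norm_scalar_conj)

lemma norm_smul: "norm (smul a x) = norm a * norm x"
proof -
  have "(of_real ((norm (smul a x))\<^sup>2) :: 'k) = (scalar_conj a * a) * ip x x"
    by (simp add: ip_self[symmetric] ip_scale_left ip_scale_right mult_ac del: of_real_power)
  also have "\<dots> = of_real ((norm a * norm x)\<^sup>2)"
    by (simp add: scalar_conj_mult_self ip_self scaleR_conv_of_real power_mult_distrib)
  finally have "(norm (smul a x))\<^sup>2 = (norm a * norm x)\<^sup>2" by (simp only: of_real_eq_iff)
  then show ?thesis by (simp add: power2_eq_iff_nonneg)
qed

text \<open>The expansion is stated in the scalar field because the cross terms need not be real. It
  serves Cauchy-Schwarz and the contraction estimate for the frame operator.\<close>

lemma norm_diff_smul_sq:
  "of_real ((norm (x - smul t y))\<^sup>2) =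
     of_real ((norm x)\<^sup>2) - scalar_conj t * ip x y - t * ip y x + of_real ((norm t)\<^sup>2 * (norm y)\<^sup>2)"
proof -
  have *: "x - smul t y = x + smul (- t) y" by simp
  have "scalar_conj (- t) = - scalar_conj t"
    using bounded_linear.linear[OF bounded_linear_scalar_conj] linear_neg by blast
  then show ?thesis
    unfolding * of_real_mult ip_self[symmetric]
    by (simp add: ip_add_left ip_add_right ip_scale_left ip_scale_right algebra_simps
        del: scale_minus_left)
      (simp add: ip_self mult.assoc[symmetric] mult_scalar_conj mult.commute)
qed

lemma norm_ip_le: "norm (ip x y) \<le> norm x * norm y"
proof (cases "y = 0")
  case True
  then show ?thesis using ip_scale_right[of x 0 y] scalar_conj_of_real[where ?'k = 'k, of 0] by simp
next
  case False
  \<comment> \<open>\<open>smul t y\<close> is the orthogonal projection of \<open>x\<close> onto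
    the line through \<open>y\<close>, and \<open>?n\<close> is its squared norm; Cauchy-Schwarz is
    the nonnegativity of the squared residual.\<close>
  define t :: 'k where "t = ip x y / of_real ((norm y)\<^sup>2)"
  let ?n = "(norm (ip x y))\<^sup>2 / (norm y)\<^sup>2"
  have ny: "(norm y)\<^sup>2 \<noteq> 0" using False by simp
  have conj_ip: "scalar_conj (ip x y) * ip x y = of_real ((norm (ip x y))\<^sup>2)"
    by (simp add: scalar_conj_mult_self scaleR_conv_of_real)
  have "t * of_real ((norm y)\<^sup>2) = ip x y" using ny by (simp add: t_def)
  then have "scalar_conj t * of_real ((norm y)\<^sup>2) = scalar_conj (ip x y)"
    by (metis scalar_conj_mult scalar_conj_of_real)
  then have ct: "scalar_conj t = scalar_conj (ip x y) / of_real ((norm y)\<^sup>2)"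
    using ny by (metis nonzero_eq_divide_eq of_real_eq_0_iff)
  have 1: "scalar_conj t * ip x y = of_real ?n"
    by (simp add: ct conj_ip[simplified])
  have 2: "t * ip y x = of_real ?n"
    by (simp add: t_def ip_commute[of y x] mult_scalar_conj)
  have 3: "(norm t)\<^sup>2 * (norm y)\<^sup>2 = ?n"
    using ny by (simp add: t_def norm_divide norm_power power_divide flip: power_mult)
      (simp add: eval_nat_numeral)
  have "(of_real ((norm (x - smul t y))\<^sup>2) :: 'k) = of_real ((norm x)\<^sup>2 - ?n)"
    unfolding norm_diff_smul_sq 1 2 3 by simp
  then have "(norm (x - smul t y))\<^sup>2 = (norm x)\<^sup>2 - ?n" by (simp only: of_real_eq_iff)
  then have "?n \<le> (norm x)\<^sup>2" by (metis zero_le_power2 diff_ge_0_iff_ge)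
  then have "(norm (ip x y))\<^sup>2 \<le> (norm x * norm y)\<^sup>2"
    using False by (simp add: divide_le_eq power_mult_distrib)
  then show ?thesis by (rule power2_le_imp_le) simp
qed

lemma bounded_linear_smul: "bounded_linear (smul a)"
proof (rule bounded_linear_intro[of _ "norm a"])
  show "smul a (r *\<^sub>R x) = r *\<^sub>R smul a x" for r x
    by (simp add: scale_of_real[symmetric] scale_left_commute)
qed (simp_all add: scale_right_distrib norm_smul)

lemma bounded_linear_ip_left: "bounded_linear (\<lambda>x. ip x y)"
proof (rule bounded_linear_intro[of _ "norm y"])
  show "ip (r *\<^sub>R x) y = r *\<^sub>R ip x y" for r x
    by (simp add: scale_of_real[symmetric] ip_scale_left scaleR_conv_of_real)
qed (simp_all add: ip_add_left norm_ip_le)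

lemma bounded_linear_ip_right: "bounded_linear (\<lambda>y. ip x y)"
  using bounded_linear_compose[OF bounded_linear_scalar_conj bounded_linear_ip_left[of x]]
  by (simp flip: ip_commute)

lemmas ip_sum_left = linear_sum[OF bounded_linear.linear[OF bounded_linear_ip_left]]
lemmas ip_sum_right = linear_sum[OF bounded_linear.linear[OF bounded_linear_ip_right]]

lemma k_linear_imp_real_linear:
  assumes "Vector_Spaces.linear smul smul U"
  shows "linear U"
  by (rule linearI)
    (use assms in \<open>auto simp: Vector_Spaces.linear_iff scale_of_real[symmetric]\<close>)

section \<open>Riesz and Bessel bounds through finite sums\<close>

text \<open>The two halves of the Riesz sequence inequality, with norms instead of squares so that
  triangle inequalities apply directly. The sign of the constant is not part of the predicates and
  is carried separately.\<close>

definition upper_on :: "'i set \<Rightarrow> ('i \<Rightarrow> 'h) \<Rightarrow> real \<Rightarrow> bool" where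
  "upper_on I f B \<longleftrightarrow> (\<forall>J c. finite J \<longrightarrow> J \<subseteq> I \<longrightarrow>
     norm (\<Sum>k\<in>J. smul (c k) (f k)) \<le> B * L2_set (\<lambda>k. norm (c k)) J)"

definition lower_on :: "'i set \<Rightarrow> ('i \<Rightarrow> 'h) \<Rightarrow> real \<Rightarrow> bool" where
  "lower_on I f A \<longleftrightarrow> (\<forall>J c. finite J \<longrightarrow> J \<subseteq> I \<longrightarrow>
     A * L2_set (\<lambda>k. norm (c k)) J \<le> norm (\<Sum>k\<in>J. smul (c k) (f k)))"

lemma upper_onD:
  "upper_on I f B \<Longrightarrow> finite J \<Longrightarrow> J \<subseteq> I \<Longrightarrow>
     norm (\<Sum>k\<in>J. smul (c k) (f k)) \<le> B * L2_set (\<lambda>k. norm (c k)) J"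
  by (simp add: upper_on_def)

lemma lower_onD:
  "lower_on I f A \<Longrightarrow> finite J \<Longrightarrow> J \<subseteq> I \<Longrightarrow>
     A * L2_set (\<lambda>k. norm (c k)) J \<le> norm (\<Sum>k\<in>J. smul (c k) (f k))"
  by (simp add: lower_on_def)

text \<open>The synthesis bound is tested on the coefficients \<open>ip x (f k)\<close>: pairing
  \<open>x\<close> with the resulting vector \<open>?v\<close> gives the square of the l2 norm, and
  one factor cancels after Cauchy-Schwarz.\<close>

lemma upper_imp_bessel:
  assumes "upper_on I f B" "0 \<le> B" "finite J" "J \<subseteq> I"
  shows "L2_set (\<lambda>k. norm (ip x (f k))) J \<le> B * norm x"
proof -
  let ?L = "L2_set (\<lambda>k. norm (ip x (f k))) J"
  let ?v = "\<Sum>k\<in>J. smul (ip x (f k)) (f k)"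
  have "ip x ?v = (\<Sum>k\<in>J. of_real ((norm (ip x (f k)))\<^sup>2))"
    by (simp add: ip_sum_right ip_scale_right mult_scalar_conj mult.commute)
  also have "\<dots> = of_real (?L\<^sup>2)"
    by (simp add: L2_set_def sum_nonneg del: of_real_power)
  finally have "?L\<^sup>2 = norm (ip x ?v)" by (simp add: norm_power)
  also have "\<dots> \<le> norm x * norm ?v" by (rule norm_ip_le)
  also have "\<dots> \<le> norm x * (B * ?L)"
    by (intro mult_left_mono upper_onD[OF assms(1,3,4)]) simp
  finally have "?L * ?L \<le> (B * norm x) * ?L" by (simp add: power2_eq_square mult_ac)
  then show ?thesis
    using L2_set_nonneg[of "\<lambda>k. norm (ip x (f k))" J] assms(2)
    by (cases "?L = 0") (auto simp: mult_le_cancel_right)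
qed

text \<open>The dual argument: the synthesized vector \<open>?v\<close> is paired with itself, and
  the Bessel bound is applied to its own coefficients \<open>ip ?v (f k)\<close>.\<close>

lemma bessel_imp_upper:
  assumes bess: "\<And>J x. finite J \<Longrightarrow> J \<subseteq> I \<Longrightarrow> L2_set (\<lambda>k. norm (ip x (f k))) J \<le> B * norm x"
    and "0 \<le> B"
  shows "upper_on I f B"
  unfolding upper_on_def
proof (intro allI impI)
  fix J :: "'a set" and c :: "'a \<Rightarrow> 'k"
  assume J: "finite J" "J \<subseteq> I"
  let ?L = "L2_set (\<lambda>k. norm (c k)) J"
  let ?v = "\<Sum>k\<in>J. smul (c k) (f k)"
  have "(norm ?v)\<^sup>2 = norm (ip ?v ?v)" by (simp add: ip_self norm_power)
  also have "\<dots> = norm (\<Sum>k\<in>J. c k * ip (f k) ?v)"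
    by (subst ip_sum_left) (simp add: ip_scale_left)
  also have "\<dots> \<le> (\<Sum>k\<in>J. norm (c k) * norm (ip ?v (f k)))"
    by (rule order_trans[OF norm_sum]) (simp add: norm_mult norm_ip_commute[of ?v])
  also have "\<dots> \<le> ?L * L2_set (\<lambda>k. norm (ip ?v (f k))) J"
    by (rule sum_le_L2_set_mult) auto
  also have "\<dots> \<le> ?L * (B * norm ?v)"
    by (intro mult_left_mono bess J) simp
  finally have "norm ?v * norm ?v \<le> (B * ?L) * norm ?v" by (simp add: power2_eq_square mult_ac)
  then show "norm ?v \<le> B * ?L"
    using assms(2) by (cases "?v = 0") (auto simp: mult_le_cancel_right)
qed

text \<open>Padding by zero turns a family over \<open>I\<close> into one over the whole index type,
  so that operators can be written as series over all naturals.\<close>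

lemma upper_on_restrict:
  assumes "upper_on I f B" "0 \<le> B"
  shows "upper_on UNIV (\<lambda>k. if k \<in> I then f k else 0) B"
  unfolding upper_on_def
proof (intro allI impI)
  fix J :: "'a set" and c :: "'a \<Rightarrow> 'k"
  assume J: "finite J"
  have "(\<Sum>k\<in>J. smul (c k) (if k \<in> I then f k else 0)) = (\<Sum>k\<in>J \<inter> I. smul (c k) (f k))"
    using J by (simp add: sum.inter_restrict if_distrib cong: if_cong)
  then have "norm (\<Sum>k\<in>J. smul (c k) (if k \<in> I then f k else 0))
      \<le> B * L2_set (\<lambda>k. norm (c k)) (J \<inter> I)"
    using upper_onD[OF assms(1), of "J \<inter> I" c] J by simp
  also have "\<dots> \<le> B * L2_set (\<lambda>k. norm (c k)) J"
    by (intro mult_left_mono L2_set_mono_set assms J) auto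
  finally show "norm (\<Sum>k\<in>J. smul (c k) (if k \<in> I then f k else 0))
      \<le> B * L2_set (\<lambda>k. norm (c k)) J" .
qed

lemma summable_bessel:
  assumes "upper_on UNIV a C" "0 \<le> C"
  shows "summable (\<lambda>k::nat. (norm (ip x (a k)))\<^sup>2)"
proof -
  have "(\<Sum>k<n. (norm (ip x (a k)))\<^sup>2) \<le> (C * norm x)\<^sup>2" for n
  proof -
    have "(L2_set (\<lambda>k. norm (ip x (a k))) {..<n})\<^sup>2 \<le> (C * norm x)\<^sup>2"
      by (intro power_mono upper_imp_bessel[OF assms]) auto
    then show ?thesis by (simp add: L2_set_def sum_nonneg)
  qed
  then show ?thesis by (intro summableI_nonneg_bounded) auto
qed

section \<open>Operators composed of analysis and synthesis\<close>

lemma summable_analysis_synthesis: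
  assumes a: "upper_on UNIV a C" "0 \<le> C" and b: "upper_on UNIV b D" "0 \<le> D"
  shows "summable (\<lambda>k::nat. smul (ip x (a k)) (b k))"
  unfolding summable_Cauchy
proof (intro allI impI)
  fix e :: real assume "0 < e"
  \<comment> \<open>The square matches the squared l2 norm of a block; \<open>D + 1\<close> avoids a
    zero denominator.\<close>
  define d where "d = (e / (D + 1))\<^sup>2"
  have "0 < d" using \<open>0 < e\<close> b(2) by (simp add: d_def)
  then obtain N where N: "\<And>m n. m \<ge> N \<Longrightarrow> norm (\<Sum>k=m..<n. (norm (ip x (a k)))\<^sup>2) < d"
    using summable_bessel[OF a, of x] unfolding summable_Cauchy by blast
  have "norm (\<Sum>k=m..<n. smul (ip x (a k)) (b k)) < e" if "m \<ge> N" for m n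
  proof -
    have "L2_set (\<lambda>k. norm (ip x (a k))) {m..<n} < e / (D + 1)"
      using N[OF that, of n] \<open>0 < e\<close> b(2)
      unfolding L2_set_def d_def by (intro real_less_lsqrt) (auto simp: sum_nonneg)
    then have "(D + 1) * L2_set (\<lambda>k. norm (ip x (a k))) {m..<n} < e"
      using b(2) by (simp add: field_simps)
    moreover have "D * L2_set (\<lambda>k. norm (ip x (a k))) {m..<n}
        \<le> (D + 1) * L2_set (\<lambda>k. norm (ip x (a k))) {m..<n}"
      by (intro mult_right_mono) auto
    ultimately show ?thesis using upper_onD[OF b(1), of "{m..<n}" "\<lambda>k. ip x (a k)"] by simp
  qed
  then show "\<exists>N. \<forall>m\<ge>N. \<forall>n. norm (\<Sum>k=m..<n. smul (ip x (a k)) (b k)) < e" by blast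
qed

text \<open>One construction covers two operators: for \<open>a = b\<close> it is the frame
  operator, and for orthonormal \<open>a\<close> it is the map carrying each \<open>a k\<close> to
  \<open>b k\<close>.\<close>

definition analysis_synthesis :: "(nat \<Rightarrow> 'h) \<Rightarrow> (nat \<Rightarrow> 'h) \<Rightarrow> 'h \<Rightarrow> 'h" where
  "analysis_synthesis a b x = (\<Sum>k. smul (ip x (a k)) (b k))"

lemma
  assumes a: "upper_on UNIV a C" "0 \<le> C" and b: "upper_on UNIV b D" "0 \<le> D"
  shows linear_analysis_synthesis: "Vector_Spaces.linear smul smul (analysis_synthesis a b)"
    and bounded_linear_analysis_synthesis: "bounded_linear (analysis_synthesis a b)"
proof -
  let ?T = "analysis_synthesis a b"
  note sm = summable_analysis_synthesis[OF a b]
  show lin: "Vector_Spaces.linear smul smul ?T"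
  proof (rule Vector_Spaces.linear_iff[THEN iffD2], intro conjI allI)
    show "vector_space smul" "vector_space smul" by unfold_locales
    show "?T (x + y) = ?T x + ?T y" for x y
      unfolding analysis_synthesis_def suminf_add[OF sm sm, of x y]
      by (simp add: ip_add_left scale_left_distrib)
    show "?T (smul c x) = smul c (?T x)" for c x
      unfolding analysis_synthesis_def
      by (simp add: ip_scale_left bounded_linear.suminf[OF bounded_linear_smul sm])
  qed
  have le: "norm (?T x) \<le> D * C * norm x" for x
  proof -
    have "(\<lambda>n. \<Sum>k<n. smul (ip x (a k)) (b k)) \<longlonglongrightarrow> ?T x"
      using sm unfolding analysis_synthesis_def by (simp add: summable_LIMSEQ)
    then show ?thesis
    proof (rule Lim_bounded[OF tendsto_norm])
      show "\<forall>n\<ge>0. norm (\<Sum>k<n. smul (ip x (a k)) (b k)) \<le> D * C * norm x"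
      proof (intro allI impI)
        fix n
        have "norm (\<Sum>k<n. smul (ip x (a k)) (b k))
            \<le> D * L2_set (\<lambda>k. norm (ip x (a k))) {..<n}"
          by (intro upper_onD[OF b(1)]) auto
        also have "\<dots> \<le> D * (C * norm x)"
          by (intro mult_left_mono upper_imp_bessel[OF a] b) auto
        finally show "norm (\<Sum>k<n. smul (ip x (a k)) (b k)) \<le> D * C * norm x"
          by (simp add: mult.assoc)
      qed
    qed
  qed
  show "bounded_linear ?T"
    by (rule bounded_linear_intro[of _ "D * C"])
      (use k_linear_imp_real_linear[OF lin] le in \<open>auto simp: linear_add linear_scale mult.commute\<close>)
qed

section \<open>Spans of indexed families and their closures\<close>

text \<open>Summing over indices rather than over vectors keeps coefficients attached to indices
  even when \<open>f\<close> repeats values, as the l2 bounds require.\<close>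

lemma span_image_eq_sums:
  "span (f ` I) = {\<Sum>k\<in>J. smul (c k) (f k) |J c. finite J \<and> J \<subseteq> I}"
    (is "_ = ?S")
proof
  have mem: "(\<Sum>k\<in>J. smul (c k) (f k)) \<in> ?S" if "finite J" "J \<subseteq> I" for J c
    using that by blast
  have "f ` I \<subseteq> ?S"
  proof
    fix y assume "y \<in> f ` I"
    then obtain i where "i \<in> I" "y = f i" by blast
    then show "y \<in> ?S" using mem[of "{i}" "\<lambda>_. 1"] by simp
  qed
  moreover have "subspace ?S"
    unfolding subspace_def
  proof (intro conjI ballI allI)
    show "0 \<in> ?S" using mem[of "{}"] by simp
  next
    fix x y assume "x \<in> ?S" "y \<in> ?S"
    then obtain J c K d where *: "finite J" "J \<subseteq> I" "x = (\<Sum>k\<in>J. smul (c k) (f k))"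
      "finite K" "K \<subseteq> I" "y = (\<Sum>k\<in>K. smul (d k) (f k))" by blast
    let ?c = "\<lambda>k. (if k \<in> J then c k else 0) + (if k \<in> K then d k else 0)"
    have r: "(\<Sum>k\<in>L. smul (c k) (f k)) = (\<Sum>k\<in>J \<union> K. smul (if k \<in> L then c k else 0) (f k))"
      if "L \<subseteq> J \<union> K" for L c
      using * that by (intro sum.mono_neutral_cong_left) auto
    have "x + y = (\<Sum>k\<in>J \<union> K. smul (?c k) (f k))"
      unfolding *(3,6) by (subst (1 2) r) (auto simp: scale_left_distrib sum.distrib)
    then show "x + y \<in> ?S" using mem[of "J \<union> K" ?c] * by simp
  next
    fix a x assume "x \<in> ?S"
    then obtain J c where *: "finite J" "J \<subseteq> I" "x = (\<Sum>k\<in>J. smul (c k) (f k))" by blast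
    then have "smul a x = (\<Sum>k\<in>J. smul (a * c k) (f k))" by (simp add: scale_sum_right)
    then show "smul a x \<in> ?S" using mem[OF *(1,2)] by simp
  qed
  ultimately show "span (f ` I) \<subseteq> ?S" by (rule span_minimal)
  show "?S \<subseteq> span (f ` I)"
    by (auto intro!: span_sum span_scale intro: span_base)
qed

lemma span_imageE:
  assumes "x \<in> span (f ` I)"
  obtains J c where "finite J" "J \<subseteq> I" "x = (\<Sum>k\<in>J. smul (c k) (f k))"
  using assms unfolding span_image_eq_sums by blast

lemma subspace_closure:
  assumes "subspace W"
  shows "subspace (closure W)"
  unfolding subspace_def
proof (intro conjI ballI allI)
  show "0 \<in> closure W" using subspace_0[OF assms] closure_subset by blast
next
  fix x y assume "x \<in> closure W" "y \<in> closure W"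
  then obtain u v where "\<And>n. u n \<in> W" "u \<longlonglongrightarrow> x" "\<And>n. v n \<in> W" "v \<longlonglongrightarrow> y"
    unfolding closure_sequential by blast
  then have "(\<forall>n. u n + v n \<in> W) \<and> (\<lambda>n. u n + v n) \<longlonglongrightarrow> x + y"
    by (simp add: tendsto_add subspace_add[OF assms])
  then show "x + y \<in> closure W" unfolding closure_sequential by (rule exI[of _ "\<lambda>n. u n + v n"])
next
  fix a x assume "x \<in> closure W"
  then have "smul a x \<in> closure (smul a ` W)"
    using closure_bounded_linear_image_subset[OF bounded_linear_smul] by blast
  moreover have "smul a ` W \<subseteq> W" using subspace_scale[OF assms] by blast
  ultimately show "smul a x \<in> closure W" using closure_mono by blast
qed

section \<open>Riesz bases characterized by two-sided bounds and totality\<close>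

lemma norm_sum_orthonormal:
  assumes "\<And>i j. i \<in> J \<Longrightarrow> j \<in> J \<Longrightarrow> ip (e i) (e j) = (if i = j then 1 else 0)" "finite J"
  shows "norm (\<Sum>k\<in>J. smul (c k) (e k)) = L2_set (\<lambda>k. norm (c k)) J"
proof -
  let ?v = "\<Sum>k\<in>J. smul (c k) (e k)"
  have "ip (e k) ?v = scalar_conj (c k)" if "k \<in> J" for k
  proof -
    have "ip (e k) ?v = (\<Sum>j\<in>J. scalar_conj (c j) * (if k = j then 1 else 0))"
      unfolding ip_sum_right using assms(1)[OF that] by (intro sum.cong) (simp_all add: ip_scale_right)
    then show ?thesis using assms(2) that by (simp add: if_distrib cong: if_cong)
  qed
  then have "ip ?v ?v = (\<Sum>k\<in>J. of_real ((norm (c k))\<^sup>2))"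
    by (subst ip_sum_left) (simp add: ip_scale_left mult_scalar_conj)
  then have "of_real ((norm ?v)\<^sup>2) = (of_real (\<Sum>k\<in>J. (norm (c k))\<^sup>2) :: 'k)"
    by (simp add: ip_self)
  then have "(norm ?v)\<^sup>2 = (\<Sum>k\<in>J. (norm (c k))\<^sup>2)" by (simp only: of_real_eq_iff)
  then show ?thesis unfolding L2_set_def by (metis norm_ge_zero real_sqrt_unique)
qed

text \<open>Orthonormal sums have exactly the l2 norm of their coefficients, so the bounds are those
  of \<open>U\<close> and of its inverse. Totality holds because a continuous surjection maps dense
  sets to dense sets.\<close>

lemma riesz_basis_onE:
  assumes "riesz_basis_on smul ip I f"
  obtains e A B where "orthonormal_basis_on smul ip I e" "0 < A" "0 \<le> B"
    "lower_on I f A" "upper_on I f B" "closure (span (f ` I)) = UNIV"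
proof -
  obtain e U where e: "orthonormal_basis_on smul ip I e"
    and U: "bounded_invertible_operator smul U" and fU: "\<And>k. k \<in> I \<Longrightarrow> f k = U (e k)"
    using assms unfolding riesz_basis_on_def by blast
  have lin: "Vector_Spaces.linear smul smul U" and bl: "bounded_linear U" and "bij U"
    and bli: "bounded_linear (inv U)"
    using U by (auto simp: bounded_invertible_operator_def)
  obtain B where B: "0 \<le> B" "\<And>x. norm (U x) \<le> norm x * B"
    using bounded_linear.nonneg_bounded[OF bl] by blast
  obtain K where K: "0 < K" "\<And>x. norm (inv U x) \<le> norm x * K"
    using bounded_linear.pos_bounded[OF bli] by blast
  have Kx: "1 / K * norm x \<le> norm (U x)" for x
    using K(2)[of "U x"] K(1) \<open>bij U\<close> by (simp add: bij_is_inj field_simps)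
  have sum: "(\<Sum>k\<in>J. smul (c k) (f k)) = U (\<Sum>k\<in>J. smul (c k) (e k))" if "J \<subseteq> I" for J c
  proof -
    have "U (\<Sum>k\<in>J. smul (c k) (e k)) = (\<Sum>k\<in>J. U (smul (c k) (e k)))"
      by (rule linear_sum[OF k_linear_imp_real_linear[OF lin]])
    also have "\<dots> = (\<Sum>k\<in>J. smul (c k) (f k))"
      using that lin fU by (intro sum.cong) (auto simp: Vector_Spaces.linear_iff)
    finally show ?thesis by simp
  qed
  have ne: "norm (\<Sum>k\<in>J. smul (c k) (e k)) = L2_set (\<lambda>k. norm (c k)) J"
    if "finite J" "J \<subseteq> I" for J c
    using e that by (intro norm_sum_orthonormal) (auto simp: orthonormal_basis_on_def subset_iff)
  have "lower_on I f (1 / K)"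
    unfolding lower_on_def
  proof (intro allI impI)
    fix J c assume J: "finite J" "J \<subseteq> I"
    show "1 / K * L2_set (\<lambda>k. norm (c k)) J \<le> norm (\<Sum>k\<in>J. smul (c k) (f k))"
      unfolding sum[OF J(2)] ne[OF J, symmetric] by (rule Kx)
  qed
  moreover have "upper_on I f B"
    unfolding upper_on_def
  proof (intro allI impI)
    fix J c assume J: "finite J" "J \<subseteq> I"
    show "norm (\<Sum>k\<in>J. smul (c k) (f k)) \<le> B * L2_set (\<lambda>k. norm (c k)) J"
      unfolding sum[OF J(2)] ne[OF J, symmetric] by (subst mult.commute) (rule B(2))
  qed
  moreover have "closure (span (f ` I)) = UNIV"
  proof -
    have "U ` span (e ` I) \<subseteq> span (f ` I)"
    proof
      fix y assume "y \<in> U ` span (e ` I)"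
      then obtain J c where "finite J" "J \<subseteq> I" "y = U (\<Sum>k\<in>J. smul (c k) (e k))"
        by (auto elim!: span_imageE)
      then show "y \<in> span (f ` I)"
        unfolding span_image_eq_sums by (auto simp: sum[symmetric])
    qed
    moreover have "U ` closure (span (e ` I)) \<subseteq> closure (U ` span (e ` I))"
      by (rule closure_bounded_linear_image_subset[OF bl])
    moreover have "U ` closure (span (e ` I)) = UNIV"
      using e \<open>bij U\<close> by (simp add: orthonormal_basis_on_def bij_is_surj)
    ultimately have "UNIV \<subseteq> closure (span (f ` I))"
      by (metis closure_mono order_trans)
    then show ?thesis by (rule top_le)
  qed
  ultimately show thesis using K(1) by (intro that[OF e _ B(1), of "1 / K"]) auto
qed

text \<open>The operator \<open>U\<close> with \<open>U (e k) = f k\<close> is built as a series.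
  The lower bound makes it injective with closed range, totality of \<open>f\<close> makes the range
  dense, and the inverse is bounded by \<open>1 / A\<close>.\<close>

lemma riesz_basis_onI:
  assumes e: "orthonormal_basis_on smul ip I e"
    and "0 < A" "0 \<le> B" and low: "lower_on I f A" and up: "upper_on I f B"
    and total: "closure (span (f ` I)) = UNIV"
  shows "riesz_basis_on smul ip I f"
proof -
  define e' where "e' k = (if k \<in> I then e k else 0)" for k
  define f' where "f' k = (if k \<in> I then f k else 0)" for k
  have orth: "ip (e i) (e j) = (if i = j then 1 else 0)" if "i \<in> I" "j \<in> I" for i j
    using e that by (auto simp: orthonormal_basis_on_def)
  have ne: "norm (\<Sum>k\<in>J. smul (c k) (e k)) = L2_set (\<lambda>k. norm (c k)) J"
    if "finite J" "J \<subseteq> I" for J c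
    using that by (intro norm_sum_orthonormal orth) auto
  have e'1: "upper_on UNIV e' 1"
    unfolding e'_def by (rule upper_on_restrict) (simp_all add: upper_on_def ne)
  have f'B: "upper_on UNIV f' B"
    unfolding f'_def by (rule upper_on_restrict[OF up \<open>0 \<le> B\<close>])
  define U where "U = analysis_synthesis e' f'"
  have lin: "Vector_Spaces.linear smul smul U"
    unfolding U_def by (rule linear_analysis_synthesis[OF e'1 _ f'B \<open>0 \<le> B\<close>]) simp
  have bl: "bounded_linear U"
    unfolding U_def by (rule bounded_linear_analysis_synthesis[OF e'1 _ f'B \<open>0 \<le> B\<close>]) simp
  interpret U: bounded_linear U by (rule bl)
  have Ue: "U (e i) = f i" if "i \<in> I" for i
  proof -
    have "(\<lambda>k. smul (ip (e i) (e' k)) (f' k)) = (\<lambda>k. if k = i then f k else 0)"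
      using that orth by (auto simp: e'_def f'_def fun_eq_iff)
    then show ?thesis
      unfolding U_def analysis_synthesis_def using sums_single[of i f] by (simp add: sums_iff)
  qed
  have Usum: "U (\<Sum>k\<in>J. smul (c k) (e k)) = (\<Sum>k\<in>J. smul (c k) (f k))" if "J \<subseteq> I" for J c
    unfolding U.sum using that lin Ue by (intro sum.cong) (auto simp: Vector_Spaces.linear_iff)
  \<comment> \<open>On the span of \<open>e\<close> this is \<open>lower_on\<close>, since
    coefficient norms equal vector norms there; the inequality defines a closed set and so passes to
    the closure.\<close>
  have below: "A * norm x \<le> norm (U x)" for x
  proof -
    have "span (e ` I) \<subseteq> {x. A * norm x \<le> norm (U x)}"
      by (auto elim!: span_imageE simp: Usum ne lower_onD[OF low])
    moreover have "closed {x. A * norm x \<le> norm (U x)}"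
      by (intro closed_Collect_le continuous_intros U.continuous_on)
    ultimately have "closure (span (e ` I)) \<subseteq> {x. A * norm x \<le> norm (U x)}"
      by (rule closure_minimal)
    then show ?thesis using e by (auto simp: orthonormal_basis_on_def)
  qed
  have "span (f ` I) \<subseteq> range U"
    by (auto elim!: span_imageE simp: Usum[symmetric])
  then have "closure (range U) = UNIV"
    using total closure_mono[of "span (f ` I)" "range U"] by auto
  then have surj: "range U = UNIV"
    by (rule range_UNIV_if_bounded_below_dense[OF bl \<open>0 < A\<close> below])
  have "inj U"
  proof (rule injI)
    fix x y assume "U x = U y"
    then show "x = y" using below[of "x - y"] \<open>0 < A\<close> by (simp add: U.diff mult_le_0_iff)
  qed
  with surj have "bij U" by (simp add: bij_def)
  have Ui: "U (inv U y) = y" for y using surj by (simp add: surj_f_inv_f)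
  have "bounded_linear (inv U)"
  proof (rule bounded_linear_intro[of _ "1 / A"])
    show "inv U (x + y) = inv U x + inv U y" for x y
      using \<open>inj U\<close> by (metis Ui U.add inv_f_f)
    show "inv U (r *\<^sub>R x) = r *\<^sub>R inv U x" for r x
      using \<open>inj U\<close> by (metis Ui U.scaleR inv_f_f)
    show "norm (inv U x) \<le> norm x * (1 / A)" for x
      using below[of "inv U x"] \<open>0 < A\<close> by (simp add: Ui field_simps)
  qed
  then have "bounded_invertible_operator smul U"
    using lin bl \<open>bij U\<close> by (simp add: bounded_invertible_operator_def)
  then show ?thesis unfolding riesz_basis_on_def using e Ue by (intro exI[of _ e] exI[of _ U]) simp
qed

text \<open>Infinite sets of naturals are in bijection. This supplies the orthonormal basis over an
  index set that may differ from the one given for \<open>f\<close>.\<close>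

lemma orthonormal_basis_on_reindex:
  assumes "orthonormal_basis_on smul ip I e" "infinite I" "infinite I'"
  shows "\<exists>e'. orthonormal_basis_on smul ip I' e'"
proof -
  obtain p where p: "bij_betw p I' I"
    using bij_betw_trans[OF bij_betw_inv_into[OF bij_enumerate[OF assms(3)]] bij_enumerate[OF assms(2)]]
    by blast
  then have "(\<lambda>k. e (p k)) ` I' = e ` I" by (metis bij_betw_def image_image)
  moreover have "p i \<in> I" if "i \<in> I'" for i using p that by (auto simp: bij_betw_def)
  moreover have "p i = p j \<longleftrightarrow> i = j" if "i \<in> I'" "j \<in> I'" for i j
    using p that by (auto simp: bij_betw_def inj_on_def)
  ultimately have "orthonormal_basis_on smul ip I' (\<lambda>k. e (p k))"
    using assms(1) by (auto simp: orthonormal_basis_on_def)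
  then show ?thesis by blast
qed

section \<open>Finitely many extra vectors preserve the frame property\<close>

lemma is_frameI:
  assumes "finite F" "0 < A" "0 \<le> B" and low: "lower_on (- F) f A" and up: "upper_on (- F) f B"
    and total: "closure (span (f ` (- F))) = UNIV"
  shows "is_frame ip f"
proof -
  \<comment> \<open>The first term bounds the Riesz part, the second bounds the indices in
    \<open>F\<close> by Cauchy-Schwarz, and the 1 makes the constant positive.\<close>
  define C where "C = B\<^sup>2 + (\<Sum>k\<in>F. (norm (f k))\<^sup>2) + 1"
  have "0 < C" by (simp add: C_def sum_nonneg add_nonneg_pos)
  have part: "(\<Sum>k\<in>J. (norm (ip x (f k)))\<^sup>2) \<le> C * (norm x)\<^sup>2" if "finite J" for J x
  proof -
    have "(\<Sum>k\<in>J - F. (norm (ip x (f k)))\<^sup>2) = (L2_set (\<lambda>k. norm (ip x (f k))) (J - F))\<^sup>2"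
      by (simp add: L2_set_def sum_nonneg)
    also have "\<dots> \<le> (B * norm x)\<^sup>2"
      using that by (intro power_mono upper_imp_bessel[OF up \<open>0 \<le> B\<close>]) auto
    finally have 1: "(\<Sum>k\<in>J - F. (norm (ip x (f k)))\<^sup>2) \<le> B\<^sup>2 * (norm x)\<^sup>2"
      by (simp add: power_mult_distrib)
    have "(\<Sum>k\<in>J \<inter> F. (norm (ip x (f k)))\<^sup>2) \<le> (\<Sum>k\<in>F. (norm (ip x (f k)))\<^sup>2)"
      using \<open>finite F\<close> by (intro sum_mono2) auto
    also have "\<dots> \<le> (\<Sum>k\<in>F. (norm x * norm (f k))\<^sup>2)"
      by (intro sum_mono power_mono norm_ip_le) auto
    finally have 2: "(\<Sum>k\<in>J \<inter> F. (norm (ip x (f k)))\<^sup>2) \<le> (\<Sum>k\<in>F. (norm (f k))\<^sup>2) * (norm x)\<^sup>2"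
      by (simp add: power_mult_distrib flip: sum_distrib_left) (simp add: mult.commute)
    have "(\<Sum>k\<in>J. (norm (ip x (f k)))\<^sup>2)
        = (\<Sum>k\<in>J \<inter> F. (norm (ip x (f k)))\<^sup>2) + (\<Sum>k\<in>J - F. (norm (ip x (f k)))\<^sup>2)"
      by (rule sum.Int_Diff[OF that])
    also have "\<dots> \<le> (B\<^sup>2 + (\<Sum>k\<in>F. (norm (f k))\<^sup>2)) * (norm x)\<^sup>2"
      using 1 2 by (simp add: distrib_right)
    also have "\<dots> \<le> C * (norm x)\<^sup>2" by (simp add: C_def distrib_right)
    finally show ?thesis .
  qed
  have sm: "summable (\<lambda>k. (norm (ip x (f k)))\<^sup>2)" for x
    by (rule summableI_nonneg_bounded[OF _ part]) auto
  have hi: "(\<Sum>k. (norm (ip x (f k)))\<^sup>2) \<le> C * (norm x)\<^sup>2" for x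
    by (rule suminf_le_const[OF sm part]) simp
  \<comment> \<open>Pairing \<open>x\<close> with a combination \<open>y\<close> of the
    \<open>f k\<close> bounds \<open>norm (ip x y)\<close> by the analysis norm \<open>?s\<close>
    times \<open>norm y / A\<close>. With \<open>y\<close> within \<open>norm x / 2\<close> of
    \<open>x\<close>, this yields \<open>A * norm x <= 3 * ?s\<close>.\<close>
  have lo: "(A / 3)\<^sup>2 * (norm x)\<^sup>2 \<le> (\<Sum>k. (norm (ip x (f k)))\<^sup>2)" for x
  proof (cases "x = 0")
    case True
    then show ?thesis using suminf_nonneg[OF sm, of x] by simp
  next
    case False
    let ?s = "sqrt (\<Sum>k. (norm (ip x (f k)))\<^sup>2)"
    have "x \<in> closure (span (f ` (- F)))" using total by simp
    then obtain y where "y \<in> span (f ` (- F))" "dist y x < norm x / 2"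
      unfolding closure_approachable using False by (metis half_gt_zero zero_less_norm_iff)
    then obtain J c where J: "finite J" "J \<subseteq> - F" and y: "y = (\<Sum>k\<in>J. smul (c k) (f k))"
      and d: "norm (x - y) < norm x / 2"
      by (auto elim!: span_imageE simp: dist_norm norm_minus_commute)
    have "norm (ip x y) = norm (\<Sum>k\<in>J. scalar_conj (c k) * ip x (f k))"
      unfolding y ip_sum_right by (simp add: ip_scale_right)
    also have "\<dots> \<le> (\<Sum>k\<in>J. norm (c k) * norm (ip x (f k)))"
      by (rule order_trans[OF norm_sum]) (simp add: norm_mult norm_scalar_conj)
    also have "\<dots> \<le> L2_set (\<lambda>k. norm (c k)) J * L2_set (\<lambda>k. norm (ip x (f k))) J"
      by (rule sum_le_L2_set_mult) auto
    also have "\<dots> \<le> (norm y / A) * ?s"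
    proof (rule mult_mono)
      show "L2_set (\<lambda>k. norm (c k)) J \<le> norm y / A"
        using lower_onD[OF low J, of c] \<open>0 < A\<close> by (simp add: y field_simps)
      show "L2_set (\<lambda>k. norm (ip x (f k))) J \<le> ?s"
        unfolding L2_set_def by (intro real_sqrt_le_mono sum_le_suminf[OF sm J(1)]) simp
    qed (use \<open>0 < A\<close> in auto)
    also have "\<dots> \<le> ((3 / 2 * norm x) / A) * ?s"
    proof -
      have "norm y \<le> 3 / 2 * norm x" using d norm_triangle_ineq3[of x y] by linarith
      then show ?thesis
        using \<open>0 < A\<close> suminf_nonneg[OF sm, of x] by (intro mult_right_mono divide_right_mono) auto
    qed
    finally have 1: "norm (ip x y) \<le> (3 / 2 * norm x) / A * ?s" .
    have "norm (ip x (x - y)) \<le> norm x * (norm x / 2)"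
      using d by (intro order_trans[OF norm_ip_le] mult_left_mono) auto
    moreover have "ip x x = ip x (x - y) + ip x y"
      by (metis ip_add_right diff_add_cancel)
    moreover have "norm (ip x x) = (norm x)\<^sup>2" by (simp add: ip_self norm_power)
    ultimately have "(norm x)\<^sup>2 \<le> norm x * (norm x / 2) + (3 / 2 * norm x) / A * ?s"
      using 1 by (metis add_mono norm_triangle_le)
    then have "norm x * (A * norm x) \<le> norm x * (3 * ?s)"
      using \<open>0 < A\<close> by (simp add: field_simps power2_eq_square)
    then have "A / 3 * norm x \<le> ?s" using False by simp
    then have "(A / 3 * norm x)\<^sup>2 \<le> ?s\<^sup>2" using \<open>0 < A\<close> by (intro power_mono) auto
    then show ?thesis using suminf_nonneg[OF sm, of x] by (simp add: power_mult_distrib power_divide)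
  qed
  have "0 < (A / 3)\<^sup>2" using \<open>0 < A\<close> by simp
  with \<open>0 < C\<close> show ?thesis
    unfolding is_frame_def using sm hi lo by blast
qed

section \<open>Stability of Riesz bounds under l1-small perturbations\<close>

text \<open>Each coefficient is at most the l2 norm of all of them, so an l1-small change of the
  vectors is a small change of synthesis.\<close>

lemma norm_sum_smul_diff_le:
  assumes "finite J" "(\<Sum>k\<in>J. norm (f k - g k)) \<le> d"
  shows "norm ((\<Sum>k\<in>J. smul (c k) (f k)) - (\<Sum>k\<in>J. smul (c k) (g k)))
    \<le> d * L2_set (\<lambda>k. norm (c k)) J"
proof -
  have "norm ((\<Sum>k\<in>J. smul (c k) (f k)) - (\<Sum>k\<in>J. smul (c k) (g k)))
      = norm (\<Sum>k\<in>J. smul (c k) (f k - g k))"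
    by (simp add: scale_right_diff_distrib sum_subtractf)
  also have "\<dots> \<le> (\<Sum>k\<in>J. norm (f k - g k) * norm (c k))"
    by (rule order_trans[OF norm_sum]) (simp add: norm_smul mult.commute)
  also have "\<dots> \<le> (\<Sum>k\<in>J. norm (f k - g k) * L2_set (\<lambda>k. norm (c k)) J)"
    by (intro sum_mono mult_left_mono member_le_L2_set assms) auto
  also have "\<dots> \<le> d * L2_set (\<lambda>k. norm (c k)) J"
    using assms(2) by (simp add: mult_right_mono flip: sum_distrib_right)
  finally show ?thesis .
qed

lemma perturbation_lower_on:
  assumes low: "lower_on I f A"
    and close: "\<And>J. finite J \<Longrightarrow> J \<subseteq> I \<Longrightarrow> (\<Sum>k\<in>J. norm (f k - g k)) \<le> d"
  shows "lower_on I g (A - d)"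
  unfolding lower_on_def
proof (intro allI impI)
  fix J c assume J: "finite J" "J \<subseteq> I"
  show "(A - d) * L2_set (\<lambda>k. norm (c k)) J \<le> norm (\<Sum>k\<in>J. smul (c k) (g k))"
    using lower_onD[OF low J, of c] norm_sum_smul_diff_le[OF J(1) close[OF J], of c]
      norm_triangle_ineq2[of "\<Sum>k\<in>J. smul (c k) (f k)" "\<Sum>k\<in>J. smul (c k) (g k)"]
    by (simp add: left_diff_distrib)
qed

lemma perturbation_upper_on:
  assumes up: "upper_on I f B"
    and close: "\<And>J. finite J \<Longrightarrow> J \<subseteq> I \<Longrightarrow> (\<Sum>k\<in>J. norm (f k - g k)) \<le> d"
  shows "upper_on I g (B + d)"
  unfolding upper_on_def
proof (intro allI impI)
  fix J c assume J: "finite J" "J \<subseteq> I"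
  show "norm (\<Sum>k\<in>J. smul (c k) (g k)) \<le> (B + d) * L2_set (\<lambda>k. norm (c k)) J"
    using upper_onD[OF up J, of c] norm_sum_smul_diff_le[OF J(1) close[OF J], of c]
      norm_triangle_ineq3[of "\<Sum>k\<in>J. smul (c k) (g k)" "\<Sum>k\<in>J. smul (c k) (f k)"]
    by (simp add: distrib_right norm_minus_commute)
qed

lemma perturbation_total:
  assumes "0 < A" "lower_on I f A" and total: "closure (span (f ` I)) = UNIV"
    and close: "\<And>J. finite J \<Longrightarrow> J \<subseteq> I \<Longrightarrow> (\<Sum>k\<in>J. norm (f k - g k)) \<le> A / 2"
  shows "closure (span (g ` I)) = UNIV"
\<comment> \<open>Approximating \<open>x\<close> by \<open>y\<close> costs 1/8, and replacing
  \<open>f\<close> by \<open>g\<close> costs half of \<open>norm y <= 9 / 8 * norm x\<close>; indeed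
  1/8 + 9/16 = 11/16.\<close>
proof (rule additive_subset_dense[where q = "11 / 16"])
  show "\<exists>w\<in>span (g ` I). norm (x - w) \<le> 11 / 16 * norm x" for x
  proof (cases "x = 0")
    case True
    then show ?thesis using span_zero by (intro bexI[of _ 0]) auto
  next
    case False
    then have "0 < norm x / 8" "x \<in> closure (span (f ` I))" using total by auto
    then obtain y where "y \<in> span (f ` I)" "dist y x < norm x / 8"
      unfolding closure_approachable by blast
    then obtain J c where J: "finite J" "J \<subseteq> I" and y: "y = (\<Sum>k\<in>J. smul (c k) (f k))"
      and d: "norm (x - y) < norm x / 8"
      by (auto elim!: span_imageE simp: dist_norm norm_minus_commute)
    let ?w = "\<Sum>k\<in>J. smul (c k) (g k)"
    have "norm (y - ?w) \<le> A / 2 * L2_set (\<lambda>k. norm (c k)) J"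
      unfolding y by (rule norm_sum_smul_diff_le[OF J(1) close[OF J]])
    also have "\<dots> \<le> norm y / 2" using lower_onD[OF assms(2) J, of c] by (simp add: y)
    finally have "norm (x - ?w) \<le> norm (x - y) + norm y / 2"
      using norm_triangle_ineq[of "x - y" "y - ?w"] by simp
    moreover have "norm y \<le> 9 / 8 * norm x" using d norm_triangle_ineq3[of x y] by linarith
    ultimately have "norm (x - ?w) \<le> 11 / 16 * norm x" using d by simp
    moreover have "?w \<in> span (g ` I)" unfolding span_image_eq_sums using J by blast
    ultimately show ?thesis by blast
  qed
qed (auto intro: span_zero span_add)

section \<open>Enlarging a Riesz sequence by finitely many vectors\<close>

text \<open>The positive distance \<open>d\<close> from \<open>h i\<close> to the span controls the
  coefficient at \<open>i\<close>; subtracting that term leaves a sum to which the old bound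
  applies.\<close>

lemma lower_on_insert:
  assumes "0 < A" "lower_on I h A" and i: "h i \<notin> closure (span (h ` I))"
  shows "\<exists>A'>0. lower_on (insert i I) h A'"
proof -
  define d where "d = infdist (h i) (span (h ` I))"
  have ne: "span (h ` I) \<noteq> {}" using span_zero by blast
  have "0 < d"
    using i in_closure_iff_infdist_zero[OF ne, of "h i"] infdist_nonneg[of "h i"]
    unfolding d_def by (simp add: order_less_le)
  \<comment> \<open>The summands bound the coefficient at \<open>i\<close> and the l2 norm of the
    remaining ones, each relative to the norm of the full sum.\<close>
  define M where "M = 1 / d + (1 + norm (h i) / d) / A"
  have "0 < M" using \<open>0 < A\<close> \<open>0 < d\<close> unfolding M_def by (intro add_pos_nonneg) auto
  have "1 / M * L2_set (\<lambda>k. norm (c k)) J \<le> norm (\<Sum>k\<in>J. smul (c k) (h k))"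
    if J: "finite J" "J \<subseteq> insert i I" for J c
  proof -
    define a where "a = (if i \<in> J then c i else 0)"
    define w where "w = (\<Sum>k\<in>J - {i}. smul (c k) (h k))"
    define v where "v = (\<Sum>k\<in>J. smul (c k) (h k))"
    define L where "L = L2_set (\<lambda>k. norm (c k)) (J - {i})"
    have J': "finite (J - {i})" "J - {i} \<subseteq> I" using J by auto
    have v: "v = smul a (h i) + w"
      unfolding v_def w_def a_def using J(1) by (simp add: sum.remove)
    have "w \<in> span (h ` I)" unfolding span_image_eq_sums w_def using J' by blast
    have 1: "norm a * d \<le> norm v"
    proof (cases "a = 0")
      case False
      have "- smul (inverse a) w \<in> span (h ` I)"
        using \<open>w \<in> span (h ` I)\<close> by (simp add: span_neg span_scale)
      then have "d \<le> norm (h i + smul (inverse a) w)"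
        unfolding d_def using infdist_le[of "- smul (inverse a) w" "span (h ` I)" "h i"]
        by (simp add: dist_norm)
      then have "norm a * d \<le> norm (smul a (h i + smul (inverse a) w))"
        by (simp add: norm_smul mult_left_mono)
      then show ?thesis using False by (simp add: v scale_right_distrib)
    qed simp
    have "A * L \<le> norm w" unfolding L_def w_def by (rule lower_onD[OF assms(2) J'])
    also have "\<dots> \<le> norm v + norm a * norm (h i)"
      using norm_triangle_ineq4[of v "smul a (h i)"] by (simp add: v norm_smul)
    also have "\<dots> \<le> norm v + norm v / d * norm (h i)"
      using 1 \<open>0 < d\<close> by (intro add_left_mono mult_right_mono) (auto simp: field_simps)
    finally have "L \<le> (norm v + norm v / d * norm (h i)) / A"
      using \<open>0 < A\<close> by (simp add: field_simps)
    moreover have "norm a \<le> norm v / d" using 1 \<open>0 < d\<close> by (simp add: field_simps)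
    moreover have "L2_set (\<lambda>k. norm (c k)) J \<le> norm a + L"
    proof (cases "i \<in> J")
      case True
      then have "L2_set (\<lambda>k. norm (c k)) J = L2_set (\<lambda>k. norm (c k)) (insert i (J - {i}))"
        by (simp add: insert_absorb)
      also have "\<dots> = sqrt ((norm a)\<^sup>2 + L\<^sup>2)"
        using J' True by (subst L2_set_insert) (simp_all add: L_def a_def)
      also have "\<dots> \<le> norm a + L" by (rule sqrt_sum_squares_le_sum) (auto simp: L_def)
      finally show ?thesis .
    qed (simp add: a_def L_def)
    ultimately have "L2_set (\<lambda>k. norm (c k)) J \<le> norm v / d + (norm v + norm v / d * norm (h i)) / A"
      by linarith
    also have "\<dots> = M * norm v" by (simp add: M_def field_simps)
    finally show ?thesis using \<open>0 < M\<close> by (simp add: v_def field_simps)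
  qed
  then have "lower_on (insert i I) h (1 / M)" by (simp add: lower_on_def)
  then show ?thesis using \<open>0 < M\<close> by (intro exI[of _ "1 / M"]) simp
qed

text \<open>Greedy selection: an index of \<open>K\<close> is skipped only when its vector already
  lies in the closed span reached so far, so no vector is lost from the final closed span.\<close>

lemma lower_on_extend:
  assumes "finite K" "0 < A" "lower_on I h A"
  shows "\<exists>J A'. J \<subseteq> K \<and> J \<inter> I = {} \<and> 0 < A' \<and> lower_on (J \<union> I) h A' \<and>
    h ` (K \<union> I) \<subseteq> closure (span (h ` (J \<union> I)))"
  using assms(1)
proof induction
  case empty
  have "h ` I \<subseteq> closure (span (h ` I))" using span_superset closure_subset by blast
  then show ?case using assms(2,3) by auto
next
  case (insert i K)
  then obtain J A' where J: "J \<subseteq> K" "J \<inter> I = {}" "0 < A'" "lower_on (J \<union> I) h A'"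
    "h ` (K \<union> I) \<subseteq> closure (span (h ` (J \<union> I)))" by blast
  show ?case
  proof (cases "h i \<in> closure (span (h ` (J \<union> I)))")
    case True
    then show ?thesis using J by (intro exI[of _ J] exI[of _ A']) auto
  next
    case False
    have sub: "h ` L \<subseteq> closure (span (h ` L))" for L
      using span_superset closure_subset by blast
    have "i \<notin> I" using False sub[of "J \<union> I"] by blast
    obtain A'' where "0 < A''" "lower_on (insert i (J \<union> I)) h A''"
      using lower_on_insert[OF J(3,4) False] by blast
    moreover have "closure (span (h ` (J \<union> I))) \<subseteq> closure (span (h ` (insert i J \<union> I)))"
      by (intro closure_mono span_mono image_mono) auto
    then have "h ` (insert i K \<union> I) \<subseteq> closure (span (h ` (insert i J \<union> I)))"
      using J(5) sub[of "insert i J \<union> I"] by blast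
    ultimately show ?thesis
      using J \<open>i \<notin> I\<close> by (intro exI[of _ "insert i J"] exI[of _ A'']) auto
  qed
qed

section \<open>Counting the removed indices\<close>

text \<open>If \<open>p\<close> is injective on \<open>J\<close>, its image is too large to be
  independent; if two indices share a value, their difference is already a relation.\<close>

lemma nontrivial_relation:
  assumes "finite J" "finite Y" "card Y < card J" "\<And>j. j \<in> J \<Longrightarrow> p j \<in> span Y"
  shows "\<exists>a. (\<exists>j\<in>J. a j \<noteq> 0) \<and> (\<Sum>j\<in>J. smul (a j) (p j)) = 0"
proof (cases "inj_on p J")
  case True
  have "dependent (p ` J)"
  proof (rule ccontr)
    assume "independent (p ` J)"
    then have "card (p ` J) \<le> card Y"
      using independent_span_bound[OF assms(2)] assms(4) by blast
    then show False using assms(3) True by (simp add: card_image)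
  qed
  then obtain u where u: "\<exists>v\<in>p ` J. u v \<noteq> 0" "(\<Sum>v\<in>p ` J. smul (u v) v) = 0"
    unfolding dependent_finite[OF finite_imageI[OF assms(1)]] by blast
  then show ?thesis
    using True by (intro exI[of _ "\<lambda>j. u (p j)"]) (auto simp: sum.reindex)
next
  case False
  then obtain i j where ij: "i \<in> J" "j \<in> J" "i \<noteq> j" "p i = p j" by (auto simp: inj_on_def)
  let ?a = "\<lambda>k. if k = i then 1 else if k = j then - 1 else 0"
  have "(\<Sum>k\<in>J. smul (?a k) (p k)) = (\<Sum>k\<in>{i, j}. smul (?a k) (p k))"
    using assms(1) ij by (intro sum.mono_neutral_right) auto
  also have "\<dots> = 0" using ij by simp
  finally show ?thesis using ij by (intro exI[of _ ?a]) auto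
qed

text \<open>
  An exchange argument modulo the closed span of the tail: a relation between approximations of the
  \<open>h\<^sub>j\<close> modulo the tail would make a combination of the \<open>h\<^sub>j\<close> and the tail too small.
\<close>

lemma card_le_if_lower_on:
  assumes "finite J" "finite K" "J \<inter> T = {}" "0 < A" and low: "lower_on (J \<union> T) h A"
    and eq: "\<And>k. k \<in> T \<Longrightarrow> g k = h k"
    and cl: "\<And>j. j \<in> J \<Longrightarrow> h j \<in> closure (span (g ` (K \<union> T)))"
  shows "card J \<le> card K"
proof (rule ccontr)
  assume "\<not> card J \<le> card K"
  define s where "s = sqrt (card J)"
  \<comment> \<open>Errors of size \<open>d\<close> at each index of \<open>J\<close> have l2 norm
    \<open>s * d\<close>, and this choice makes \<open>s * d < A\<close>, which the final comparison
    contradicts.\<close>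
  define d where "d = A / (s + 1)"
  have "0 \<le> s" by (simp add: s_def)
  then have "0 < d" using \<open>0 < A\<close> by (simp add: d_def)
  have "\<exists>p m. p \<in> span (g ` K) \<and> m \<in> span (g ` T) \<and> norm (h j - (p + m)) \<le> d" if j: "j \<in> J" for j
  proof -
    obtain y where "y \<in> span (g ` (K \<union> T))" "dist y (h j) < d"
      using cl[OF j] \<open>0 < d\<close> unfolding closure_approachable by blast
    moreover from this obtain p m where "p \<in> span (g ` K)" "m \<in> span (g ` T)" "y = p + m"
      unfolding image_Un span_Un by blast
    ultimately show ?thesis
      by (intro exI[of _ p] exI[of _ m]) (simp add: dist_norm norm_minus_commute)
  qed
  then obtain p m where p: "\<And>j. j \<in> J \<Longrightarrow> p j \<in> span (g ` K)"
    and m: "\<And>j. j \<in> J \<Longrightarrow> m j \<in> span (g ` T)"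
    and near: "\<And>j. j \<in> J \<Longrightarrow> norm (h j - (p j + m j)) \<le> d"
    by metis
  have "card (g ` K) < card J"
    using \<open>\<not> card J \<le> card K\<close> card_image_le[OF \<open>finite K\<close>, of g] by linarith
  then obtain a j0 where j0: "j0 \<in> J" "a j0 \<noteq> 0" and rel: "(\<Sum>j\<in>J. smul (a j) (p j)) = 0"
    using nontrivial_relation[of J "g ` K" p] assms(1,2) p by blast
  let ?L = "L2_set (\<lambda>j. norm (a j)) J"
  have "0 < norm (a j0)" using j0 by simp
  also have "\<dots> \<le> ?L" by (rule member_le_L2_set[OF assms(1) j0(1)])
  finally have "0 < ?L" .
  have "g ` T = h ` T" using eq by (auto simp: image_iff)
  then have "(\<Sum>j\<in>J. smul (a j) (m j)) \<in> span (h ` T)"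
    using m by (auto intro!: span_sum span_scale)
  then obtain T' c where T': "finite T'" "T' \<subseteq> T"
    and sum_m: "(\<Sum>j\<in>J. smul (a j) (m j)) = (\<Sum>k\<in>T'. smul (c k) (h k))"
    by (rule span_imageE)
  \<comment> \<open>The relation removes the \<open>p\<close>-parts, and the coefficients
    \<open>- c k\<close> on the tail subtract the \<open>m\<close>-parts, so only the approximation
    errors survive.\<close>
  define b where "b k = (if k \<in> J then a k else - c k)" for k
  have disj: "J \<inter> T' = {}" using T' assms(3) by blast
  have "(\<Sum>k\<in>J \<union> T'. smul (b k) (h k)) = (\<Sum>k\<in>J. smul (b k) (h k)) + (\<Sum>k\<in>T'. smul (b k) (h k))"
    by (rule sum.union_disjoint[OF assms(1) T'(1) disj])
  also have "(\<Sum>k\<in>J. smul (b k) (h k)) = (\<Sum>k\<in>J. smul (a k) (h k))"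
    by (intro sum.cong) (auto simp: b_def)
  also have "(\<Sum>k\<in>T'. smul (b k) (h k)) = - (\<Sum>k\<in>T'. smul (c k) (h k))"
    unfolding sum_negf[symmetric] using disj by (intro sum.cong) (auto simp: b_def)
  finally have "(\<Sum>k\<in>J \<union> T'. smul (b k) (h k))
      = (\<Sum>j\<in>J. smul (a j) (h j)) - (\<Sum>j\<in>J. smul (a j) (p j)) - (\<Sum>j\<in>J. smul (a j) (m j))"
    by (simp add: rel sum_m)
  also have "\<dots> = (\<Sum>j\<in>J. smul (a j) (h j - (p j + m j)))"
    by (simp add: scale_right_diff_distrib scale_right_distrib sum_subtractf sum.distrib)
  also have "norm \<dots> \<le> (\<Sum>j\<in>J. norm (a j) * norm (h j - (p j + m j)))"
    by (rule order_trans[OF norm_sum]) (simp add: norm_smul)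
  also have "\<dots> \<le> ?L * L2_set (\<lambda>j. norm (h j - (p j + m j))) J"
    by (rule sum_le_L2_set_mult) auto
  also have "\<dots> \<le> ?L * L2_set (\<lambda>j. d) J"
    by (intro mult_left_mono L2_set_mono near) auto
  also have "\<dots> = ?L * (s * d)" using \<open>0 < d\<close> by (simp add: L2_set_constant s_def)
  finally have "norm (\<Sum>k\<in>J \<union> T'. smul (b k) (h k)) \<le> ?L * (s * d)" .
  moreover have "A * ?L \<le> A * L2_set (\<lambda>k. norm (b k)) (J \<union> T')"
  proof -
    have "?L = L2_set (\<lambda>k. norm (b k)) J" by (intro L2_set_cong) (auto simp: b_def)
    also have "\<dots> \<le> L2_set (\<lambda>k. norm (b k)) (J \<union> T')"
      using assms(1) T'(1) by (intro L2_set_mono_set) auto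
    finally show ?thesis using \<open>0 < A\<close> by simp
  qed
  moreover have "A * L2_set (\<lambda>k. norm (b k)) (J \<union> T') \<le> norm (\<Sum>k\<in>J \<union> T'. smul (b k) (h k))"
    using assms(1) T' by (intro lower_onD[OF low]) auto
  ultimately have "A * ?L \<le> (s * d) * ?L" by (simp add: mult.commute)
  then have "A \<le> s * d" using \<open>0 < ?L\<close> by (simp add: mult_le_cancel_right)
  then show False using \<open>0 < A\<close> \<open>0 \<le> s\<close> by (simp add: d_def field_simps)
qed

text \<open>Cut at \<open>M\<close> beyond \<open>F\<close>, \<open>F'\<close> and \<open>N\<close>,
  both index sets end in the same tail, and their heads have \<open>M - card F\<close> and
  \<open>M - card F'\<close> elements. The exchange lemma compares the heads; subtraction from
  \<open>M\<close> reverses the inequality.\<close>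

lemma card_removed_le:
  fixes g h :: "nat \<Rightarrow> 'h"
  assumes "finite F" "finite F'" "0 < A" "lower_on (- F') h A" "closure (span (g ` (- F))) = UNIV"
    and "\<And>k. N \<le> k \<Longrightarrow> g k = h k"
  shows "card F \<le> card F'"
proof -
  obtain n where n: "\<And>k. k \<in> F \<union> F' \<Longrightarrow> k < n"
    using assms(1,2) finite_nat_set_iff_bounded by (metis finite_UnI)
  define M where "M = max N n"
  have FM: "F \<subseteq> {..<M}" "F' \<subseteq> {..<M}" using n by (force simp: M_def)+
  have split: "- G = ({..<M} - G) \<union> {M..}" if "G \<subseteq> {..<M}" for G
    using that by auto
  have "card ({..<M} - F') \<le> card ({..<M} - F)"
  proof (rule card_le_if_lower_on)
    show "lower_on (({..<M} - F') \<union> {M..}) h A"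
      using assms(4) split[OF FM(2)] by simp
    show "h j \<in> closure (span (g ` (({..<M} - F) \<union> {M..})))" for j
      using assms(5) split[OF FM(1)] by simp
    show "g k = h k" if "k \<in> {M..}" for k using assms(6) that by (simp add: M_def)
  qed (use assms in auto)
  moreover have "card ({..<M} - G) = M - card G" "card G \<le> M" if "G \<subseteq> {..<M}" for G
    using that by (auto simp: card_Diff_subset finite_subset dest: card_mono[rotated])
  ultimately show ?thesis using FM by (metis diff_le_mono2 diff_diff_cancel)
qed

section \<open>The frame operator and its invertibility\<close>

lemma is_frame_imp_upper_on:
  assumes "is_frame ip f"
  obtains B where "0 \<le> B" "upper_on UNIV f B"
proof -
  obtain B where "B > 0" and sm: "\<And>x. summable (\<lambda>k. (norm (ip x (f k)))\<^sup>2)"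
    and hi: "\<And>x. (\<Sum>k. (norm (ip x (f k)))\<^sup>2) \<le> B * (norm x)\<^sup>2"
    using assms unfolding is_frame_def by blast
  have "upper_on UNIV f (sqrt B)"
  proof (rule bessel_imp_upper)
    show "L2_set (\<lambda>k. norm (ip x (f k))) J \<le> sqrt B * norm x" if "finite J" for J x
    proof -
      have "(\<Sum>k\<in>J. (norm (ip x (f k)))\<^sup>2) \<le> B * (norm x)\<^sup>2"
        using sum_le_suminf[OF sm that, of x] hi[of x] by simp
      then have "L2_set (\<lambda>k. norm (ip x (f k))) J \<le> sqrt (B * (norm x)\<^sup>2)"
        unfolding L2_set_def by (rule real_sqrt_le_mono)
      then show ?thesis by (simp add: real_sqrt_mult)
    qed
  qed (use \<open>B > 0\<close> in simp)
  then show thesis using that[of "sqrt B"] \<open>B > 0\<close> by simp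
qed

lemma frame_operator_eq: "frame_operator smul ip f = analysis_synthesis f f"
  by (simp add: fun_eq_iff frame_operator_def analysis_synthesis_def)

lemma frame_operator_sums:
  assumes "is_frame ip f"
  shows "(\<lambda>k. smul (ip x (f k)) (f k)) sums frame_operator smul ip f x"
proof -
  obtain B where "0 \<le> B" "upper_on UNIV f B" using is_frame_imp_upper_on[OF assms] .
  then show ?thesis
    unfolding frame_operator_def using summable_analysis_synthesis by (intro summable_sums) blast
qed

lemma bounded_linear_frame_operator:
  assumes "is_frame ip f"
  shows "bounded_linear (frame_operator smul ip f)"
proof -
  obtain B where B: "0 \<le> B" "upper_on UNIV f B" using is_frame_imp_upper_on[OF assms] .
  show ?thesis
    unfolding frame_operator_eq by (rule bounded_linear_analysis_synthesis[OF B(2,1) B(2,1)])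
qed

lemma ip_frame_operator_sums:
  assumes "is_frame ip f"
  shows "(\<lambda>k. ip x (f k) * ip (f k) y) sums ip (frame_operator smul ip f x) y"
  using bounded_linear.sums[OF bounded_linear_ip_left frame_operator_sums[OF assms], of x y]
  by (simp add: ip_scale_left)

text \<open>Conjugating the series of \<open>ip (S y) x\<close>, with \<open>S\<close> the frame
  operator, term by term gives the series of \<open>ip (S x) y\<close>.\<close>

lemma frame_operator_self_adjoint:
  assumes "is_frame ip f"
  shows "ip (frame_operator smul ip f x) y = ip x (frame_operator smul ip f y)"
proof -
  have "(\<lambda>k. scalar_conj (ip y (f k) * ip (f k) x))
      sums scalar_conj (ip (frame_operator smul ip f y) x)"
    by (rule bounded_linear.sums[OF bounded_linear_scalar_conj ip_frame_operator_sums[OF assms]])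
  then have "(\<lambda>k. ip x (f k) * ip (f k) y) sums ip x (frame_operator smul ip f y)"
    by (simp add: scalar_conj_mult mult.commute flip: ip_commute)
  then show ?thesis using ip_frame_operator_sums[OF assms] sums_unique2 by blast
qed

text \<open>
  For small \<open>c > 0\<close> the operator \<open>I - c S\<close> is a contraction, because \<open>S\<close> is bounded and bounded
  below in the quadratic form sense; hence the range of \<open>S\<close> is dense.
\<close>

lemma bij_frame_operator:
  assumes "is_frame ip f"
  shows "bij (frame_operator smul ip f)"
proof -
  let ?S = "frame_operator smul ip f"
  interpret S: bounded_linear ?S by (rule bounded_linear_frame_operator[OF assms])
  obtain A where "0 < A" and sm: "\<And>x. summable (\<lambda>k. (norm (ip x (f k)))\<^sup>2)"
    and lo: "\<And>x. A * (norm x)\<^sup>2 \<le> (\<Sum>k. (norm (ip x (f k)))\<^sup>2)"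
    using assms unfolding is_frame_def by blast
  obtain B0 where "0 < B0" and B0: "\<And>x. norm (?S x) \<le> norm x * B0" using S.pos_bounded by blast
  define B where "B = A + B0"
  have "0 < B" "A < B" using \<open>0 < A\<close> \<open>0 < B0\<close> by (auto simp: B_def)
  have B: "norm (?S x) \<le> norm x * B" for x
    using B0[of x] \<open>0 < A\<close> by (simp add: B_def distrib_left add_increasing)
  have Sxx: "ip (?S x) x = of_real (\<Sum>k. (norm (ip x (f k)))\<^sup>2)" for x
  proof -
    have "ip x (f k) * ip (f k) x = of_real ((norm (ip x (f k)))\<^sup>2)" for k
      by (simp add: ip_commute[of "f k" x] mult_scalar_conj)
    then have "(\<lambda>k. of_real ((norm (ip x (f k)))\<^sup>2)) sums ip (?S x) x"
      using ip_frame_operator_sums[OF assms, of x x] by simp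
    moreover have "(\<lambda>k. of_real ((norm (ip x (f k)))\<^sup>2) :: 'k) sums of_real (\<Sum>k. (norm (ip x (f k)))\<^sup>2)"
      by (rule sums_of_real[OF summable_sums[OF sm]])
    ultimately show ?thesis by (rule sums_unique2)
  qed
  have below: "A * norm x \<le> norm (?S x)" for x
  proof -
    have "(A * norm x) * norm x \<le> norm (ip (?S x) x)"
      using lo[of x] by (simp add: Sxx power2_eq_square suminf_nonneg[OF sm])
    also have "\<dots> \<le> norm (?S x) * norm x" by (rule norm_ip_le)
    finally show ?thesis by (cases "x = 0") (auto simp: mult_le_cancel_right)
  qed
  \<comment> \<open>This value minimizes the quadratic bound 1 - 2cA + c^2 B^2, whose minimum is 1 -
    A^2/B^2.\<close>
  define c where "c = A / B\<^sup>2"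
  have "0 < c" using \<open>0 < A\<close> \<open>0 < B\<close> by (simp add: c_def)
  have contr: "(norm (x - c *\<^sub>R ?S x))\<^sup>2 \<le> (1 - A\<^sup>2 / B\<^sup>2) * (norm x)\<^sup>2" for x
  proof -
    let ?q = "\<Sum>k. (norm (ip x (f k)))\<^sup>2"
    have "ip x (?S x) = of_real ?q" using frame_operator_self_adjoint[OF assms] Sxx by metis
    then have "(of_real ((norm (x - c *\<^sub>R ?S x))\<^sup>2) :: 'k)
        = of_real ((norm x)\<^sup>2 - 2 * c * ?q + c\<^sup>2 * (norm (?S x))\<^sup>2)"
      using norm_diff_smul_sq[of x "of_real c" "?S x"]
      by (simp add: scale_of_real scalar_conj_of_real Sxx)
    then have "(norm (x - c *\<^sub>R ?S x))\<^sup>2 = (norm x)\<^sup>2 - 2 * c * ?q + c\<^sup>2 * (norm (?S x))\<^sup>2"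
      by (simp only: of_real_eq_iff)
    also have "\<dots> \<le> (norm x)\<^sup>2 - 2 * c * (A * (norm x)\<^sup>2) + c\<^sup>2 * (norm x * B)\<^sup>2"
      using \<open>0 < c\<close> lo B by (intro add_mono diff_mono mult_left_mono power_mono) auto
    also have "\<dots> = (1 - A\<^sup>2 / B\<^sup>2) * (norm x)\<^sup>2"
      using \<open>0 < B\<close> by (simp add: c_def field_simps power2_eq_square)
    finally show ?thesis .
  qed
  have "closure (range ?S) = UNIV"
  proof (rule additive_subset_dense)
    show "sqrt (1 - A\<^sup>2 / B\<^sup>2) < 1" using \<open>0 < A\<close> \<open>0 < B\<close> by simp
    show "\<exists>w\<in>range ?S. norm (x - w) \<le> sqrt (1 - A\<^sup>2 / B\<^sup>2) * norm x" for x
    proof (intro bexI)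
      have "norm (x - c *\<^sub>R ?S x) \<le> sqrt ((1 - A\<^sup>2 / B\<^sup>2) * (norm x)\<^sup>2)"
        by (rule real_le_rsqrt[OF contr])
      then show "norm (x - ?S (c *\<^sub>R x)) \<le> sqrt (1 - A\<^sup>2 / B\<^sup>2) * norm x"
        by (simp add: S.scaleR real_sqrt_mult)
    qed simp
  qed (auto simp: image_iff intro: exI[of _ 0] simp flip: S.add)
  then have "range ?S = UNIV"
    by (rule range_UNIV_if_bounded_below_dense[OF S.bounded_linear \<open>0 < A\<close> below])
  moreover have "inj ?S"
  proof (rule injI)
    fix x y assume "?S x = ?S y"
    then show "x = y" using below[of "x - y"] \<open>0 < A\<close> by (simp add: S.diff mult_le_0_iff)
  qed
  ultimately show ?thesis by (simp add: bij_def)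
qed


section \<open>Consequences of closeness in the weighted sum\<close>

lemma total_if_close_to_frame:
  assumes fr: "is_frame ip f"
    and sm: "summable (\<lambda>k. norm (f k - h k) * norm (inv (frame_operator smul ip f) (f k)))"
    and less: "(\<Sum>k. norm (f k - h k) * norm (inv (frame_operator smul ip f) (f k))) < 1"
  shows "closure (span (range h)) = UNIV"
proof (rule additive_subset_dense)
  let ?S = "frame_operator smul ip f"
  define \<mu> where "\<mu> = (\<Sum>k. norm (f k - h k) * norm (inv ?S (f k)))"
  have S_inv: "?S (inv ?S x) = x" for x
    using bij_frame_operator[OF fr] by (simp add: bij_is_surj surj_f_inv_f)
  \<comment> \<open>Only finite sums lie in the span, so the series for \<open>x\<close> is
    truncated; replacing \<open>f\<close> by \<open>h\<close> costs \<open>\<mu>\<close>, and the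
    slack \<open>(1 - \<mu>) / 2\<close> absorbs the truncation.\<close>
  show "(1 + \<mu>) / 2 < 1" using less by (simp add: \<mu>_def)
  show "\<exists>w\<in>span (range h). norm (x - w) \<le> (1 + \<mu>) / 2 * norm x" for x
  proof (cases "x = 0")
    case True
    then show ?thesis using span_zero by (intro bexI[of _ 0]) auto
  next
    case False
    define a where "a k = ip (inv ?S x) (f k)" for k
    \<comment> \<open>Self-adjointness moves the inverse onto \<open>f k\<close>, bringing out the
      weights of the hypothesis through Cauchy-Schwarz.\<close>
    have a: "a k = ip x (inv ?S (f k))" for k
      using frame_operator_self_adjoint[OF fr, of "inv ?S x" "inv ?S (f k)"]
      by (simp add: S_inv a_def)
    have "(\<lambda>n. \<Sum>k<n. smul (a k) (f k)) \<longlonglongrightarrow> x"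
      using frame_operator_sums[OF fr, of "inv ?S x"] by (simp add: sums_def S_inv a_def)
    moreover have "0 < (1 - \<mu>) / 2 * norm x" using less False by (simp add: \<mu>_def)
    ultimately obtain n where n: "norm ((\<Sum>k<n. smul (a k) (f k)) - x) < (1 - \<mu>) / 2 * norm x"
      using LIMSEQ_D by blast
    let ?w = "\<Sum>k<n. smul (a k) (h k)"
    have "(\<Sum>k<n. smul (a k) (f k)) - ?w = (\<Sum>k<n. smul (a k) (f k - h k))"
      by (simp add: scale_right_diff_distrib sum_subtractf)
    also have "norm \<dots> \<le> (\<Sum>k<n. norm x * (norm (f k - h k) * norm (inv ?S (f k))))"
    proof (rule sum_norm_le)
      show "norm (smul (a k) (f k - h k)) \<le> norm x * (norm (f k - h k) * norm (inv ?S (f k)))" for k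
        using mult_right_mono[OF norm_ip_le[of x "inv ?S (f k)"] norm_ge_zero[of "f k - h k"]]
        by (simp add: norm_smul a mult_ac)
    qed
    also have "\<dots> \<le> norm x * \<mu>"
      unfolding \<mu>_def sum_distrib_left[symmetric]
      by (intro mult_left_mono sum_le_suminf[OF sm]) auto
    finally have "norm ((\<Sum>k<n. smul (a k) (f k)) - ?w) \<le> norm x * \<mu>" .
    then have "norm (x - ?w) \<le> (1 - \<mu>) / 2 * norm x + norm x * \<mu>"
      using n norm_triangle_ineq[of "x - (\<Sum>k<n. smul (a k) (f k))" "(\<Sum>k<n. smul (a k) (f k)) - ?w"]
      by (simp add: norm_minus_commute)
    also have "\<dots> = (1 + \<mu>) / 2 * norm x" by (simp add: field_simps)
    finally have "norm (x - ?w) \<le> (1 + \<mu>) / 2 * norm x" .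
    moreover have "?w \<in> span (range h)" by (intro span_sum span_scale span_base) auto
    ultimately show ?thesis by blast
  qed
qed (auto intro: span_zero span_add)

lemma summable_norm_diff:
  assumes fr: "is_frame ip f" and "finite F" "0 < A" "lower_on (- F) f A"
    and sm: "summable (\<lambda>k. norm (f k - h k) * norm (inv (frame_operator smul ip f) (f k)))"
  shows "summable (\<lambda>k. norm (f k - h k))"
proof -
  let ?S = "frame_operator smul ip f"
  interpret S: bounded_linear ?S by (rule bounded_linear_frame_operator[OF fr])
  obtain K where "0 < K" and K: "\<And>x. norm (?S x) \<le> norm x * K" using S.pos_bounded by blast
  have "norm (norm (f k - h k)) \<le> K / A * (norm (f k - h k) * norm (inv ?S (f k)))" if "k \<notin> F" for k
  proof -
    \<comment> \<open>The lower Riesz bound for a single index with coefficient 1.\<close>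
    have "A \<le> norm (f k)" using lower_onD[OF assms(4), of "{k}" "\<lambda>_. 1"] that by simp
    also have "\<dots> \<le> norm (inv ?S (f k)) * K"
      using K[of "inv ?S (f k)"] bij_frame_operator[OF fr] by (simp add: bij_is_surj surj_f_inv_f)
    finally have "norm (f k - h k) * A \<le> norm (f k - h k) * (norm (inv ?S (f k)) * K)"
      by (rule mult_left_mono) simp
    then show ?thesis using \<open>0 < A\<close> by (simp add: field_simps)
  qed
  moreover have "\<forall>\<^sub>F k in sequentially. k \<notin> F"
    using assms(2) by (simp add: eventually_cofinite flip: cofinite_eq_sequentially)
  ultimately have "\<forall>\<^sub>F k in sequentially.
      norm (norm (f k - h k)) \<le> K / A * (norm (f k - h k) * norm (inv ?S (f k)))"
    by (auto elim: eventually_mono)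
  then show ?thesis by (rule summable_comparison_test_ev) (rule summable_mult[OF sm])
qed

section \<open>Excess and the perturbation theorem\<close>

lemma excess_eqI:
  assumes "finite F" "riesz_basis_on smul ip (- F) f"
    and "\<And>F'. finite F' \<Longrightarrow> riesz_basis_on smul ip (- F') f \<Longrightarrow> card F' = card F"
  shows "excess smul ip f = card F"
  unfolding excess_def
proof (rule Least_equality)
  show "\<exists>F'. finite F' \<and> card F' = card F \<and> riesz_basis_on smul ip (- F') f"
    using assms(1,2) by (intro exI[of _ F]) simp
  show "card F \<le> n" if "\<exists>F'. finite F' \<and> card F' = n \<and> riesz_basis_on smul ip (- F') f" for n
    using that by (elim exE conjE) (simp add: assms(3)[symmetric])
qed

lemma near_riesz_basis_perturbation:
  assumes f: "near_riesz_basis smul ip f"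
    and sm: "summable (\<lambda>k. norm (f k - h k) * norm (inv (frame_operator smul ip f) (f k)))"
    and less: "(\<Sum>k. norm (f k - h k) * norm (inv (frame_operator smul ip f) (f k))) < 1"
  shows "near_riesz_basis smul ip h \<and> excess smul ip f = excess smul ip h"
proof -
  obtain F where fr: "is_frame ip f" and "finite F" and rf: "riesz_basis_on smul ip (- F) f"
    using f by (auto simp: near_riesz_basis_def)
  obtain e A B where e: "orthonormal_basis_on smul ip (- F) e" and "0 < A"
    and low: "lower_on (- F) f A" and total: "closure (span (f ` (- F))) = UNIV"
    using riesz_basis_onE[OF rf] by metis
  have sd: "summable (\<lambda>k. norm (f k - h k))"
    by (rule summable_norm_diff[OF fr \<open>finite F\<close> \<open>0 < A\<close> low sm])
  obtain C where "0 \<le> C" and C: "upper_on UNIV f C" using is_frame_imp_upper_on[OF fr] .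
  \<comment> \<open>The Bessel bound of \<open>f\<close> plus the l1 distance gives one upper
    constant for \<open>h\<close> valid on every index set.\<close>
  define D where "D = C + (\<Sum>k. norm (f k - h k))"
  have "0 \<le> D" using \<open>0 \<le> C\<close> suminf_nonneg[OF sd] by (simp add: D_def)
  have "upper_on UNIV h D"
    unfolding D_def by (rule perturbation_upper_on[OF C]) (auto intro: sum_le_suminf[OF sd])
  then have up: "upper_on I h D" for I by (simp add: upper_on_def)
  \<comment> \<open>A tail below \<open>A / 2\<close> leaves the lower constant \<open>A / 2\<close>
    and meets the threshold of \<open>perturbation_total\<close>.\<close>
  obtain N0 where N0: "\<And>m n. N0 \<le> m \<Longrightarrow> norm (\<Sum>k=m..<n. norm (f k - h k)) < A / 2"
    using sd \<open>0 < A\<close> unfolding summable_Cauchy by (meson half_gt_zero)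
  obtain N1 where N1: "F \<subseteq> {..<N1}"
    using finite_nat_iff_bounded[THEN iffD1, OF \<open>finite F\<close>] by blast
  define N where "N = max N0 N1"
  define g where "g k = (if k < N then f k else h k)" for k
  have close: "(\<Sum>k\<in>J. norm (f k - g k)) \<le> A / 2" if J: "finite J" for J
  proof -
    obtain n where n: "J \<subseteq> {..<n}" using finite_nat_iff_bounded[THEN iffD1, OF J] by blast
    have "(\<Sum>k\<in>J. norm (f k - g k)) = (\<Sum>k\<in>J \<inter> {N..}. norm (f k - h k))"
      using that by (intro sum.mono_neutral_cong_right) (auto simp: g_def)
    also have "\<dots> \<le> (\<Sum>k=N..<n. norm (f k - h k))"
      using n by (intro sum_mono2) auto
    also have "\<dots> \<le> A / 2" using N0[of N n] by (simp add: N_def sum_nonneg)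
    finally show ?thesis .
  qed
  have lowg: "lower_on (- F) g (A / 2)"
    using perturbation_lower_on[OF low close] by simp
  have totalg: "closure (span (g ` (- F))) = UNIV"
    by (rule perturbation_total[OF \<open>0 < A\<close> low total close])
  have gh: "g k = h k" if "N \<le> k" for k using that by (simp add: g_def)
  \<comment> \<open>From \<open>N\<close> on, \<open>h\<close> coincides with \<open>g\<close>, and
    \<open>N1 <= N\<close> places this tail inside \<open>- F\<close>.\<close>
  have "lower_on {N..} h (A / 2)"
    unfolding lower_on_def
  proof (intro allI impI)
    fix J c assume J: "finite J" "J \<subseteq> {N..}"
    have "J \<subseteq> - F" using J(2) N1 by (fastforce simp: N_def)
    moreover have "(\<Sum>k\<in>J. smul (c k) (g k)) = (\<Sum>k\<in>J. smul (c k) (h k))"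
      using J(2) gh by (intro sum.cong) auto
    ultimately show "A / 2 * L2_set (\<lambda>k. norm (c k)) J \<le> norm (\<Sum>k\<in>J. smul (c k) (h k))"
      using lower_onD[OF lowg J(1)] by metis
  qed
  then obtain J A' where J: "J \<subseteq> {..<N}" and "0 < A'" and lowh: "lower_on (J \<union> {N..}) h A'"
    and cl: "h ` ({..<N} \<union> {N..}) \<subseteq> closure (span (h ` (J \<union> {N..})))"
    using lower_on_extend[of "{..<N}" "A / 2" "{N..}" h] \<open>0 < A\<close> by auto
  have "{..<N} \<union> {N..} = UNIV" by auto
  then have "range h \<subseteq> closure (span (h ` (J \<union> {N..})))"
    using cl by simp
  then have "span (range h) \<subseteq> closure (span (h ` (J \<union> {N..})))"
    by (intro span_minimal subspace_closure subspace_span)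
  then have "closure (span (range h)) \<subseteq> closure (span (h ` (J \<union> {N..})))"
    by (rule closure_minimal) simp
  then have totalh: "closure (span (h ` (J \<union> {N..}))) = UNIV"
    using total_if_close_to_frame[OF fr sm less] by auto
  define F' where "F' = {..<N} - J"
  have "finite F'" by (simp add: F'_def)
  have F': "- F' = J \<union> {N..}" using J by (auto simp: F'_def)
  have "infinite (- F)" "infinite (- F')"
    using \<open>finite F\<close> \<open>finite F'\<close> by (simp_all add: Compl_eq_Diff_UNIV)
  then obtain e' where "orthonormal_basis_on smul ip (- F') e'"
    using orthonormal_basis_on_reindex[OF e] by blast
  then have rh: "riesz_basis_on smul ip (- F') h"
    by (rule riesz_basis_onI[OF _ \<open>0 < A'\<close> \<open>0 \<le> D\<close>]) (use lowh up totalh in \<open>simp_all add: F'\<close>)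
  have "is_frame ip h"
    by (rule is_frameI[OF \<open>finite F'\<close> \<open>0 < A'\<close> \<open>0 \<le> D\<close>]) (use lowh up totalh in \<open>simp_all add: F'\<close>)
  then have near: "near_riesz_basis smul ip h"
    unfolding near_riesz_basis_def using \<open>finite F'\<close> rh by blast
  \<comment> \<open>Compared with \<open>g\<close>, which shares its tail with \<open>h\<close> and
    is a total Riesz sequence on \<open>- F\<close>; \<open>card_removed_le\<close> is used in both
    directions.\<close>
  have cardh: "card G = card F" if "finite G" and G: "riesz_basis_on smul ip (- G) h" for G
  proof -
    obtain a where "0 < a" "lower_on (- G) h a" "closure (span (h ` (- G))) = UNIV"
      using riesz_basis_onE[OF G] by metis
    then show ?thesis
      using card_removed_le[OF \<open>finite F\<close> \<open>finite G\<close>, of a h g N]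
        card_removed_le[OF \<open>finite G\<close> \<open>finite F\<close>, of "A / 2" g h N] \<open>0 < A\<close> lowg totalg gh
      by (intro antisym) auto
  qed
  \<comment> \<open>The same comparison of \<open>f\<close> with itself: any two removals leaving a
    Riesz basis have equal size, so the minimum defining the excess is attained at
    \<open>F\<close>.\<close>
  have cardf: "card G = card F" if "finite G" and G: "riesz_basis_on smul ip (- G) f" for G
  proof -
    obtain a where "0 < a" "lower_on (- G) f a" "closure (span (f ` (- G))) = UNIV"
      using riesz_basis_onE[OF G] by metis
    then show ?thesis
      using card_removed_le[OF \<open>finite F\<close> \<open>finite G\<close>, of a f f]
        card_removed_le[OF \<open>finite G\<close> \<open>finite F\<close>, of A f f] \<open>0 < A\<close> low total
      by (intro antisym) auto
  qed
  have "excess smul ip f = card F" by (rule excess_eqI[OF \<open>finite F\<close> rf cardf])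
  moreover have "excess smul ip h = card F'"
    using cardh[OF \<open>finite F'\<close> rh] cardh by (intro excess_eqI[OF \<open>finite F'\<close> rh]) simp
  ultimately show ?thesis using near cardh[OF \<open>finite F'\<close> rh] by simp
qed

end

theorem corollary2p2:
  fixes smul :: "'k::hilbert_scalar \<Rightarrow> 'h::banach \<Rightarrow> 'h"
    and ip :: "'h \<Rightarrow> 'h \<Rightarrow> 'k"
    and f h :: "nat \<Rightarrow> 'h"
  assumes "hilbert_space smul ip"
    and "near_riesz_basis smul ip f"
    and "summable (\<lambda>k. norm (f k - h k) * norm (inv (frame_operator smul ip f) (f k)))"
    and "(\<Sum>k. norm (f k - h k) * norm (inv (frame_operator smul ip f) (f k))) < 1"
  shows "near_riesz_basis smul ip h \<and> excess smul ip f = excess smul ip h"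
  by (rule hilbert_space.near_riesz_basis_perturbation[OF assms])

end
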